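(* Let $(V,\{f_i\}_{i\in I})$ be a dual perfect space and let $\mathbf{B}$ and $\mathbf{B}'$ be two dual perfect bases of it. Assume that $p_H(\mathbf{B}_H)=p_H(\mathbf{B}'_H)$. Then there is an isomorphism of abstract crystals $\psi\colon \mathbf{B}\to\mathbf{B}'$ (with $\mathbf{B}$, $\mathbf{B}'$ regarded as dual perfect graphs) such that $p_H(b)=p_H(\psi(b))$ for all $b\in\mathbf{B}_H$. Moreover, for any $b\in\mathbf{B}$ and any good sequence $\mathbf{i}$ in $I$, we have $\mathrm{L}(\mathbf{i},b)=\mathrm{L}(\mathbf{i},\psi(b))$ and $p_H(\mathbf{e}^{\mathrm{top}}_{\mathbf{i}}b)=p_H(\mathbf{e}^{\mathrm{top}}_{\mathbf{i}}\psi(b))\in p_H(\mathbf{B}_H)$.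
   Context: **Borcherds–Cartan datum.** Let $I$ be an index set. A symmetrizable Borcherds–Cartan matrix is an integral matrix $A=(a_{ij})_{i,j\in I}$ with $a_{ii}=2$ or $a_{ii}\le 0$; $a_{ij}\le 0$ for $i\ne j$; $a_{ij}=0\iff a_{ji}=0$; and $DA$ symmetric for some $D=\mathrm{diag}(s_i\in\mathbb{Z}_{>0})_{i\in I}$. Assume $a_{ii}\in 2\mathbb{Z}$ for all $i$. Put $I^{\mathrm{re}}=\{i: a_{ii}=2\}$, $I^{\mathrm{im}}=\{i:a_{ii}\le0\}$. Fix a Borcherds–Cartan datum $(A,P,\Pi,\Pi^\vee)$: $P$ is a free abelian group, $\Pi=\{\alpha_i\}_{i\in I}\subset P$ is linearly independent, $\Pi^\vee=\{h_i\}_{i\in I}\subset P^\vee=\mathrm{Hom}(P,\mathbb{Z})$, $\langle h_i,\alpha_j\rangle=a_{ij}$, and for each $i$ there is $\Lambda_i\in P$ with $\langle h_j,\Lambda_i\rangle=\delta_{ij}$ for all $j$. Put $Q^+=\sum_i\mathbb{Z}_{\ge0}\alpha_i$. **Dual perfect bases.** Let $\mathbf{k}$ be a field, $V=\bigoplus_{\mu\in P}V_\mu$ a $P$-graded $\mathbf{k}$-vector space, $\{f_i\}_{i\in I}$ endomorphisms of $V$. $(V,\{f_i\})$ is a pre-dual perfect space if (1) there are finitely many $\lambda_1,\dots,\lambda_k\in P$ with $\mathrm{wt}(V):=\{\mu:V_\mu\ne0\}\subset\bigcup_j(\lambda_j-Q^+)$, and (2) $f_i(V_\mu)\subset V_{\mu-\alpha_i}$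 for all $i,\mu$. For $v\in V\setminus\{0\}$, $\ell_i(v)$ is the integer $n\ge0$ with $v\in f_i^nV\setminus f_i^{n+1}V$. A basis $\mathbf{B}$ of $V$ is a dual perfect basis if (a) $\mathbf{B}=\bigsqcup_\mu\mathbf{B}_\mu$, $\mathbf{B}_\mu=\mathbf{B}\cap V_\mu$; (b) for any $i\in I$ there is a map $\mathbf{f}_i\colon\mathbf{B}\to\mathbf{B}\cup\{0\}$ such that for any $b\in\mathbf{B}$ there is $c\in\mathbf{k}^\times$ with $f_i(b)-c\,\mathbf{f}_i(b)\in f_i^{\ell_i(b)+2}V$; (c) if $\mathbf{f}_i(b)=\mathbf{f}_i(b')\ne0$ then $b=b'$. $V$ is a dual perfect space if it is pre-dual perfect and has a dual perfect basis. **Dual perfect graph.** For a dual perfect basis $\mathbf{B}$ and $b\in\mathbf{B}$: $\mathbf{e}_ib=b'$ if $b'\in\mathbf{B}$ and $\mathbf{f}_ib'=b$, and $\mathbf{e}_ib=0$ if no such $b'$ exists; $\mathrm{wt}(b)=\mu$ if $b\in\mathbf{B}_\mu$; $\varepsilon_i(b)=\ell_i(b)$ if $i\in I^{\mathrm{re}}$, $\varepsilon_i(b)=0$ if $i\in I^{\mathrm{im}}$; $\varphi_i(b)=\varepsilon_i(b)+\langle h_i,\mathrm{wt}(b)\rangle$. The set $\mathbf{B}$ with $(\mathbf{e}_i,\mathbf{f}_i,\varepsilon_i,\varphi_i,\mathrm{wt})$ is an abstract crystal, called the dual perfect graph. An isomorphism of abstract crystals is a bijection preserving $\mathrm{wt},\varepsilon_i,\varphi_i$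 and commuting with all $\mathbf{e}_i,\mathbf{f}_i$ (where $0\mapsto0$). **Sequences.** A sequence $\mathbf{i}=(i_k)_{k\ge1}$ in $I$ is good if $\{k: i_k=i\}$ is infinite for every $i\in I$. A sequence $\mathfrak{l}=(l_k)_{k\ge1}$ of non-negative integers is good if $l_k=0$ for $k\gg0$. Good integer sequences are ordered lexicographically: $\mathfrak{l}\prec\mathfrak{l}'$ iff for some $k\ge1$, $l_s=l'_s$ for $1\le s<k$ and $l_k<l'_k$. Set $V^{>\mathfrak{l},\mathbf{i}}=\sum_{k\ge1}f_{i_1}^{l_1}\cdots f_{i_{k-1}}^{l_{k-1}}f_{i_k}^{1+l_k}V$ and $V^{\ge\mathfrak{l},\mathbf{i}}=V^{>\mathfrak{l},\mathbf{i}}+f_{i_1}^{l_1}\cdots f_{i_m}^{l_m}V$ for $m\gg0$. For $v\in V\setminus\{0\}$, $\mathrm{L}(\mathbf{i},v)$ is the largest good sequence $\mathfrak{l}$ with $v\in V^{\ge\mathfrak{l},\mathbf{i}}$ (it exists). Set $\mathbf{B}_H=\{b\in\mathbf{B}:\ell_i(b)=0\text{ for all }i\in I\}$ (similarly $\mathbf{B}'_H$), $\mathbf{e}_i^{\mathrm{top}}b=\mathbf{e}_i^{\ell_i(b)}b\in\mathbf{B}$, and $\mathbf{e}_{\mathbf{i}}^{\mathrm{top}}b=\mathbf{e}_{i_m}^{\mathrm{top}}\cdots\mathbf{e}_{i_1}^{\mathrm{top}}b$ for $m\gg0$ (independent of $m\gg0$). Let $p_H\colon V\to V_H:=V/\sum_{i\in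 I}f_iV$ be the canonical projection. *)

theory Defs
  imports Complex_Main "HOL-Library.Set_Algebras" "HOL-Library.Disjoint_Sets"
begin

section \<open>Abelian groups as modules over the integers\<close>

definition zscale :: "int \<Rightarrow> 'p::ab_group_add \<Rightarrow> 'p" where
  "zscale n x = (((+) x) ^^ nat n) 0 - (((+) x) ^^ nat (- n)) 0"

lemma funpow_plus_add:
  "(((+) x) ^^ (m + n)) 0 = (((+) x) ^^ m) 0 + (((+) x) ^^ n) (0::'p::ab_group_add)"
  by (induction m) (simp_all add: add.assoc)

lemma funpow_plus_distrib:
  "(((+) (x + y)) ^^ n) 0 = (((+) x) ^^ n) 0 + (((+) y) ^^ n) (0::'p::ab_group_add)"
  by (induction n) (simp_all add: algebra_simps)

lemma zscale_diff:
  "zscale (int m - int n) x = (((+) x) ^^ m) 0 - (((+) x) ^^ n) (0::'p::ab_group_add)"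
proof (cases "n \<le> m")
  case True
  then obtain k where "m = n + k" using le_Suc_ex by blast
  then show ?thesis by (simp add: zscale_def funpow_plus_add)
next
  case False
  then obtain k where "n = m + k" by (metis le_Suc_ex nat_le_linear)
  then show ?thesis by (simp add: zscale_def funpow_plus_add)
qed

lemma zscale_of_nat: "zscale (int n) x = (((+) x) ^^ n) (0::'p::ab_group_add)"
  by (simp add: zscale_def)

lemma zscale_add_right: "zscale n (x + y) = zscale n x + zscale n (y::'p::ab_group_add)"
  by (simp add: zscale_def funpow_plus_distrib)

lemma zscale_add_left: "zscale (a + b) x = zscale a x + zscale b (x::'p::ab_group_add)"
proof -
  obtain m n where a: "a = int m - int n" by (rule int_diff_cases)
  obtain k l where b: "b = int k - int l" by (rule int_diff_cases)
  have "a + b = int (m + k) - int (n + l)" by (simp add: a b)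
  then have "zscale (a + b) x = (((+) x) ^^ (m + k)) 0 - (((+) x) ^^ (n + l)) 0"
    by (simp only: zscale_diff)
  then show ?thesis by (simp add: a b zscale_diff funpow_plus_add)
qed

lemma zscale_uminus_left: "zscale (- a) x = - zscale a (x::'p::ab_group_add)"
  by (simp add: zscale_def)

lemma zscale_mult_nat: "zscale (int n * b) x = zscale (int n) (zscale b (x::'p::ab_group_add))"
proof (induction n)
  case 0
  show ?case by (simp add: zscale_def)
next
  case (Suc n)
  have "zscale (int (Suc n) * b) x = zscale (b + int n * b) x"
    by (simp add: algebra_simps)
  then show ?case using Suc by (simp only: zscale_add_left zscale_of_nat) simp
qed

lemma module_zscale: "module (zscale :: int \<Rightarrow> 'p::ab_group_add \<Rightarrow> 'p)"
proof
  fix a b :: int and x y :: 'p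
  show "zscale a (x + y) = zscale a x + zscale a y" by (rule zscale_add_right)
  show "zscale (a + b) x = zscale a x + zscale b x" by (rule zscale_add_left)
  show "zscale 1 x = x" by (simp add: zscale_def)
  show "zscale a (zscale b x) = zscale (a * b) x"
  proof (cases "a \<ge> 0")
    case True
    then show ?thesis by (metis nat_0_le zscale_mult_nat)
  next
    case False
    then obtain n where "a = - int n" by (metis minus_minus nat_0_le neg_0_le_iff_le linear)
    then show ?thesis by (simp add: zscale_uminus_left zscale_mult_nat)
  qed
qed

section \<open>Borcherds-Cartan data\<close>

text \<open>The lattice P is the whole type \<open>'p\<close>; the index set I is a set, so it may be empty.
  The linear independence of the family \<open>\<alpha>\<close> is injectivity together with linear independence of
  its image. In the last axiom \<open>\<Lambda>\<close> is only required to exist, it is not part of the datum.\<close>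

locale borcherds_cartan_datum =
  fixes I :: "'i set"
    and a :: "'i \<Rightarrow> 'i \<Rightarrow> int"
    and \<alpha> :: "'i \<Rightarrow> 'p::ab_group_add"
    and h :: "'i \<Rightarrow> 'p \<Rightarrow> int"
  assumes diag: "i \<in> I \<Longrightarrow> a i i = 2 \<or> a i i \<le> 0"
    and off_diag: "i \<in> I \<Longrightarrow> j \<in> I \<Longrightarrow> i \<noteq> j \<Longrightarrow> a i j \<le> 0"
    and zero_iff: "i \<in> I \<Longrightarrow> j \<in> I \<Longrightarrow> a i j = 0 \<longleftrightarrow> a j i = 0"
    and symmetrizable:
      "\<exists>s :: 'i \<Rightarrow> int. (\<forall>i\<in>I. s i > 0) \<and> (\<forall>i\<in>I. \<forall>j\<in>I. s i * a i j = s j * a j i)"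
    and even_diag: "i \<in> I \<Longrightarrow> even (a i i)"
    and free: "\<exists>X :: 'p set. \<not> module.dependent zscale X \<and> module.span zscale X = UNIV"
    and inj_root: "inj_on \<alpha> I"
    and indep_root: "\<not> module.dependent zscale (\<alpha> ` I)"
    and additive_coroot: "i \<in> I \<Longrightarrow> additive (h i)"
    and pairing: "i \<in> I \<Longrightarrow> j \<in> I \<Longrightarrow> h i (\<alpha> j) = a i j"
    and fundamental_weight:
      "i \<in> I \<Longrightarrow> \<exists>\<Lambda> :: 'p. \<forall>j\<in>I. h j \<Lambda> = (if i = j then 1 else 0)"

definition I_re :: "'i set \<Rightarrow> ('i \<Rightarrow> 'i \<Rightarrow> int) \<Rightarrow> 'i set" where
  "I_re I a = {i \<in> I. a i i = 2}"

definition Qplus :: "'i set \<Rightarrow> ('i \<Rightarrow> 'p::ab_group_add) \<Rightarrow> 'p set" where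
  "Qplus I \<alpha> = {(\<Sum>i\<in>J. zscale (int (n i)) (\<alpha> i)) | J n. finite J \<and> J \<subseteq> I}"

section \<open>Dual perfect spaces and dual perfect bases\<close>

text \<open>The vector space V is the whole type \<open>'v\<close>, and \<open>Vg \<mu>\<close> is its component of
  degree \<open>\<mu>\<close>.\<close>

locale graded_vector_space = vector_space scale
  for scale :: "'k::field \<Rightarrow> 'v::ab_group_add \<Rightarrow> 'v" +
  fixes Vg :: "'p \<Rightarrow> 'v set"
  assumes subspace_component: "subspace (Vg \<mu>)"
    and direct_sum:
      "\<exists>!x :: 'p \<Rightarrow> 'v. (\<forall>\<mu>. x \<mu> \<in> Vg \<mu>) \<and> finite {\<mu>. x \<mu> \<noteq> 0} \<and> v = (\<Sum>\<mu> | x \<mu> \<noteq> 0. x \<mu>)"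

locale pre_dual_perfect_space = graded_vector_space scale Vg
  for scale :: "'k::field \<Rightarrow> 'v::ab_group_add \<Rightarrow> 'v"
    and Vg :: "'p::ab_group_add \<Rightarrow> 'v set" +
  fixes I :: "'i set"
    and \<alpha> :: "'i \<Rightarrow> 'p"
    and f :: "'i \<Rightarrow> 'v \<Rightarrow> 'v"
  assumes linear_f: "i \<in> I \<Longrightarrow> Vector_Spaces.linear scale scale (f i)"
    and weights_bounded:
      "\<exists>S. finite S \<and> {\<mu>. Vg \<mu> \<noteq> {0}} \<subseteq> (\<Union>\<nu>\<in>S. {\<nu> - \<beta> | \<beta>. \<beta> \<in> Qplus I \<alpha>})"
    and f_degree: "i \<in> I \<Longrightarrow> f i ` Vg \<mu> \<subseteq> Vg (\<mu> - \<alpha> i)"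

definition ell :: "('i \<Rightarrow> 'v \<Rightarrow> 'v) \<Rightarrow> 'i \<Rightarrow> 'v \<Rightarrow> nat" where
  "ell f i v = (THE n. v \<in> range (f i ^^ n) - range (f i ^^ Suc n))"

text \<open>The maps \<open>F i\<close> on the basis are carried along explicitly. Their values in
  \<open>B \<union> {0}\<close> use the zero vector, which is never in the basis \<open>B\<close>. The values of \<open>F i\<close> outside
  \<open>B\<close> and for \<open>i \<notin> I\<close> are irrelevant.\<close>

definition dual_perfect_basis ::
  "('k::field \<Rightarrow> 'v::ab_group_add \<Rightarrow> 'v) \<Rightarrow> ('p \<Rightarrow> 'v set) \<Rightarrow> 'i set \<Rightarrow> ('i \<Rightarrow> 'v \<Rightarrow> 'v)
    \<Rightarrow> 'v set \<Rightarrow> ('i \<Rightarrow> 'v \<Rightarrow> 'v) \<Rightarrow> bool" where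
  "dual_perfect_basis scale Vg I f B F \<longleftrightarrow>
     \<not> module.dependent scale B \<and> module.span scale B = UNIV \<and>
     B = (\<Union>\<mu>. B \<inter> Vg \<mu>) \<and> disjoint_family (\<lambda>\<mu>. B \<inter> Vg \<mu>) \<and>
     (\<forall>i\<in>I. F i ` B \<subseteq> B \<union> {0} \<and>
        (\<forall>b\<in>B. \<exists>c. c \<noteq> 0 \<and> f i b - scale c (F i b) \<in> range (f i ^^ (ell f i b + 2)))) \<and>
     (\<forall>i\<in>I. \<forall>b\<in>B. \<forall>b'\<in>B. F i b = F i b' \<and> F i b \<noteq> 0 \<longrightarrow> b = b')"

definition dual_perfect_space ::
  "('k::field \<Rightarrow> 'v::ab_group_add \<Rightarrow> 'v) \<Rightarrow> ('p::ab_group_add \<Rightarrow> 'v set) \<Rightarrow> 'i set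
    \<Rightarrow> ('i \<Rightarrow> 'p) \<Rightarrow> ('i \<Rightarrow> 'v \<Rightarrow> 'v) \<Rightarrow> bool" where
  "dual_perfect_space scale Vg I \<alpha> f \<longleftrightarrow>
     pre_dual_perfect_space scale Vg I \<alpha> f \<and> (\<exists>B F. dual_perfect_basis scale Vg I f B F)"

section \<open>Crystals and dual perfect graphs\<close>

text \<open>The formal element 0 adjoined to a crystal is the constant \<open>0\<close> of the ambient type. An
  isomorphism is accordingly extended by \<open>\<psi> 0 = 0\<close>.\<close>

record ('i, 'p, 'b) crystal =
  crystal_carrier :: "'b set"
  crystal_wt :: "'b \<Rightarrow> 'p"
  crystal_e :: "'i \<Rightarrow> 'b \<Rightarrow> 'b"
  crystal_f :: "'i \<Rightarrow> 'b \<Rightarrow> 'b"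
  crystal_eps :: "'i \<Rightarrow> 'b \<Rightarrow> int"
  crystal_phi :: "'i \<Rightarrow> 'b \<Rightarrow> int"

definition crystal_iso ::
  "'i set \<Rightarrow> ('i, 'p, 'b::zero) crystal \<Rightarrow> ('i, 'p, 'c::zero) crystal \<Rightarrow> ('b \<Rightarrow> 'c) \<Rightarrow> bool" where
  "crystal_iso I C D \<psi> \<longleftrightarrow>
     bij_betw \<psi> (crystal_carrier C) (crystal_carrier D) \<and> \<psi> 0 = 0 \<and>
     (\<forall>b\<in>crystal_carrier C.
        crystal_wt D (\<psi> b) = crystal_wt C b \<and>
        (\<forall>i\<in>I. crystal_eps D i (\<psi> b) = crystal_eps C i b \<and>
               crystal_phi D i (\<psi> b) = crystal_phi C i b \<and>
               crystal_e D i (\<psi> b) = \<psi> (crystal_e C i b) \<and>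
               crystal_f D i (\<psi> b) = \<psi> (crystal_f C i b)))"

definition bold_e :: "'v::zero set \<Rightarrow> ('i \<Rightarrow> 'v \<Rightarrow> 'v) \<Rightarrow> 'i \<Rightarrow> 'v \<Rightarrow> 'v" where
  "bold_e B F i b =
     (if b \<in> B \<and> (\<exists>b'\<in>B. F i b' = b) then (THE b'. b' \<in> B \<and> F i b' = b) else 0)"

definition wt_of :: "('p \<Rightarrow> 'v set) \<Rightarrow> 'v \<Rightarrow> 'p" where
  "wt_of Vg b = (THE \<mu>. b \<in> Vg \<mu>)"

definition eps_of ::
  "'i set \<Rightarrow> ('i \<Rightarrow> 'i \<Rightarrow> int) \<Rightarrow> ('i \<Rightarrow> 'v \<Rightarrow> 'v) \<Rightarrow> 'i \<Rightarrow> 'v \<Rightarrow> int" where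
  "eps_of I a f i b = (if i \<in> I_re I a then int (ell f i b) else 0)"

definition dual_perfect_graph ::
  "'i set \<Rightarrow> ('i \<Rightarrow> 'i \<Rightarrow> int) \<Rightarrow> ('i \<Rightarrow> 'p \<Rightarrow> int) \<Rightarrow> ('p \<Rightarrow> 'v::zero set)
    \<Rightarrow> ('i \<Rightarrow> 'v \<Rightarrow> 'v) \<Rightarrow> 'v set \<Rightarrow> ('i \<Rightarrow> 'v \<Rightarrow> 'v) \<Rightarrow> ('i, 'p, 'v) crystal" where
  "dual_perfect_graph I a h Vg f B F =
     \<lparr> crystal_carrier = B,
       crystal_wt = wt_of Vg,
       crystal_e = bold_e B F,
       crystal_f = F,
       crystal_eps = eps_of I a f,
       crystal_phi = (\<lambda>i b. eps_of I a f i b + h i (wt_of Vg b)) \<rparr>"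

definition highest :: "'i set \<Rightarrow> ('i \<Rightarrow> 'v \<Rightarrow> 'v) \<Rightarrow> 'v set \<Rightarrow> 'v set" where
  "highest I f B = {b \<in> B. \<forall>i\<in>I. ell f i b = 0}"

text \<open>The quotient of V by \<open>\<Sum>i\<in>I. f i V\<close> is represented by the cosets in V.\<close>

definition pH ::
  "('k::field \<Rightarrow> 'v::ab_group_add \<Rightarrow> 'v) \<Rightarrow> 'i set \<Rightarrow> ('i \<Rightarrow> 'v \<Rightarrow> 'v) \<Rightarrow> 'v \<Rightarrow> 'v set" where
  "pH scale I f v = v +o module.span scale (\<Union>i\<in>I. range (f i))"

section \<open>Good sequences\<close>

text \<open>Sequences are indexed from 0: the k-th term of a sequence in the literature is the term
  with index \<open>k - 1\<close> here.\<close>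

definition good_index_seq :: "'i set \<Rightarrow> (nat \<Rightarrow> 'i) \<Rightarrow> bool" where
  "good_index_seq I ii \<longleftrightarrow> range ii \<subseteq> I \<and> (\<forall>i\<in>I. infinite {k. ii k = i})"

definition good_nat_seq :: "(nat \<Rightarrow> nat) \<Rightarrow> bool" where
  "good_nat_seq l \<longleftrightarrow> (\<forall>\<^sub>F k in sequentially. l k = 0)"

definition lex_less :: "(nat \<Rightarrow> nat) \<Rightarrow> (nat \<Rightarrow> nat) \<Rightarrow> bool" where
  "lex_less l l' \<longleftrightarrow> (\<exists>k. (\<forall>s<k. l s = l' s) \<and> l k < l' k)"

text \<open>\<open>f_prod f ii l m\<close> is the product of the powers \<open>f (ii k) ^^ l k\<close> for \<open>k < m\<close>, with
  \<open>k = 0\<close> leftmost.\<close>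

primrec f_prod :: "('i \<Rightarrow> 'v \<Rightarrow> 'v) \<Rightarrow> (nat \<Rightarrow> 'i) \<Rightarrow> (nat \<Rightarrow> nat) \<Rightarrow> nat \<Rightarrow> 'v \<Rightarrow> 'v" where
  "f_prod f ii l 0 = id"
| "f_prod f ii l (Suc m) = f_prod f ii l m \<circ> (f (ii m) ^^ l m)"

definition V_gt ::
  "('k::field \<Rightarrow> 'v::ab_group_add \<Rightarrow> 'v) \<Rightarrow> ('i \<Rightarrow> 'v \<Rightarrow> 'v) \<Rightarrow> (nat \<Rightarrow> nat) \<Rightarrow> (nat \<Rightarrow> 'i)
    \<Rightarrow> 'v set" where
  "V_gt scale f l ii =
     module.span scale (\<Union>k. range (f_prod f ii l k \<circ> (f (ii k) ^^ (1 + l k))))"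

text \<open>For a good sequence \<open>l\<close> the range of \<open>f_prod f ii l m\<close> does not depend on \<open>m\<close> once \<open>m\<close> is
  large.\<close>

definition V_ge ::
  "('k::field \<Rightarrow> 'v::ab_group_add \<Rightarrow> 'v) \<Rightarrow> ('i \<Rightarrow> 'v \<Rightarrow> 'v) \<Rightarrow> (nat \<Rightarrow> nat) \<Rightarrow> (nat \<Rightarrow> 'i)
    \<Rightarrow> 'v set" where
  "V_ge scale f l ii =
     {v. \<forall>\<^sub>F m in sequentially. v \<in> V_gt scale f l ii + range (f_prod f ii l m)}"

definition L_seq ::
  "('k::field \<Rightarrow> 'v::ab_group_add \<Rightarrow> 'v) \<Rightarrow> ('i \<Rightarrow> 'v \<Rightarrow> 'v) \<Rightarrow> (nat \<Rightarrow> 'i) \<Rightarrow> 'v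
    \<Rightarrow> nat \<Rightarrow> nat" where
  "L_seq scale f ii v =
     (THE l. good_nat_seq l \<and> v \<in> V_ge scale f l ii \<and>
        (\<forall>l'. good_nat_seq l' \<and> v \<in> V_ge scale f l' ii \<longrightarrow> l' = l \<or> lex_less l' l))"

definition e_top ::
  "('i \<Rightarrow> 'v \<Rightarrow> 'v) \<Rightarrow> 'v::zero set \<Rightarrow> ('i \<Rightarrow> 'v \<Rightarrow> 'v) \<Rightarrow> 'i \<Rightarrow> 'v \<Rightarrow> 'v" where
  "e_top f B F i b = (bold_e B F i ^^ ell f i b) b"

primrec e_top_upto ::
  "('i \<Rightarrow> 'v \<Rightarrow> 'v) \<Rightarrow> 'v::zero set \<Rightarrow> ('i \<Rightarrow> 'v \<Rightarrow> 'v) \<Rightarrow> (nat \<Rightarrow> 'i) \<Rightarrow> nat \<Rightarrow> 'v \<Rightarrow> 'v" where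
  "e_top_upto f B F ii 0 b = b"
| "e_top_upto f B F ii (Suc m) b = e_top f B F (ii m) (e_top_upto f B F ii m b)"

definition e_top_seq ::
  "('i \<Rightarrow> 'v \<Rightarrow> 'v) \<Rightarrow> 'v::zero set \<Rightarrow> ('i \<Rightarrow> 'v \<Rightarrow> 'v) \<Rightarrow> (nat \<Rightarrow> 'i) \<Rightarrow> 'v \<Rightarrow> 'v" where
  "e_top_seq f B F ii b = (THE c. \<forall>\<^sub>F m in sequentially. e_top_upto f B F ii m b = c)"

end

theory Submission
  imports Defs
begin

text \<open>Call a subspace compatible with a basis if it is spanned by the basis vectors it contains. Every
  dual perfect basis is compatible with the components \<open>Vg \<mu>\<close>, with the images of the powers of
  \<open>f i\<close>, and hence, because \<open>W\<close> compatible makes \<open>f i ^^ n ` W + range (f i ^^ (n + 1))\<close>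
  compatible, with the filtrations \<open>V_gt\<close> and \<open>V_ge\<close>. Two basis vectors \<open>b\<close> and \<open>b'\<close> are linked
  if no subspace compatible with both bases separates them.

  A linked vector is found by a one-dimensional subquotient \<open>W / U\<close> of subspaces compatible with
  both bases that is spanned by the image of \<open>b\<close>: each basis then has exactly one vector in
  \<open>W - U\<close>. For \<open>b\<close> in \<open>highest I f B\<close> take \<open>U = rad = (\<Sum>i\<in>I. f i V)\<close> and \<open>W = span b + U\<close>, which
  is compatible with the second basis by the hypothesis on \<open>pH\<close>. The subquotient is moved from
  \<open>b\<close> to \<open>F i b\<close> by applying \<open>f i\<close>, so induction on the weight reaches all of \<open>B\<close>. Being linked is
  thus a bijection, it preserves every invariant defined through compatible subspaces, and it
  commutes with the \<open>F i\<close> by the way subquotients are moved. No good sequence is needed to define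
  it, so \<open>I\<close> may be uncountable.\<close>

section \<open>Subspaces compatible with a basis\<close>

text \<open>A copy of \<open>vector_space\<close>: definitions made in \<open>vector_space\<close> itself would clash with their
  instances for \<open>real_vector\<close>.\<close>

locale basis_compatibility = vector_space scale
  for scale :: "'a::field \<Rightarrow> 'b::ab_group_add \<Rightarrow> 'b" (infixr \<open>*s\<close> 75)
begin

definition compatible :: "'b set \<Rightarrow> 'b set \<Rightarrow> bool" where
  "compatible B W \<longleftrightarrow> W = span (B \<inter> W)"

lemma compatible_imp_subspace: "compatible B W \<Longrightarrow> subspace W"
  by (metis compatible_def subspace_span)

text \<open>Otherwise \<open>S\<close> lies in \<open>B - {b}\<close> and \<open>b\<close> depends
  on it. Consequently a basis vector in a sum of compatible subspaces lies in one of the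
  summands.\<close>

lemma independent_in_span_subset:
  assumes "independent B" "S \<subseteq> B" "b \<in> B" "b \<in> span S"
  shows "b \<in> S"
proof (rule ccontr)
  assume "b \<notin> S"
  then have "S \<subseteq> B - {b}" using assms by auto
  then show False using assms span_mono dependent_def by blast
qed

lemma compatible_span:
  assumes "independent B" "S \<subseteq> B"
  shows "compatible B (span S)"
proof -
  have "B \<inter> span S = S"
    using assms independent_in_span_subset span_superset by blast
  then show ?thesis by (simp add: compatible_def)
qed

lemma compatible_Union:
  assumes "\<And>W. W \<in> \<W> \<Longrightarrow> compatible B W"
  shows "compatible B (span (\<Union>\<W>))"
proof -
  have "W \<subseteq> span (B \<inter> span (\<Union>\<W>))" if "W \<in> \<W>" for W
  proof -
    have "W = span (B \<inter> W)" using assms[OF that] by (simp add: compatible_def)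
    also have "\<dots> \<subseteq> span (B \<inter> span (\<Union>\<W>))"
      using that span_superset[of "\<Union>\<W>"] by (intro span_mono) auto
    finally show ?thesis .
  qed
  then have "span (\<Union>\<W>) \<subseteq> span (B \<inter> span (\<Union>\<W>))"
    by (intro span_minimal) auto
  moreover have "span (B \<inter> span (\<Union>\<W>)) \<subseteq> span (\<Union>\<W>)"
    by (intro span_minimal) auto
  ultimately show ?thesis by (auto simp: compatible_def)
qed

lemma compatible_Un:
  assumes "compatible B W" "compatible B X"
  shows "compatible B (span (W \<union> X))"
  using compatible_Union[of "{W, X}" B] assms by auto

text \<open>Coordinates in the basis \<open>B\<close> are unique, so those expressing
  \<open>v\<close> through \<open>B \<inter> W\<close> and through \<open>B \<inter> X\<close>
  agree, and their support lies in both sets.\<close>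

lemma compatible_Int:
  assumes B: "independent B" and W: "compatible B W" and X: "compatible B X"
  shows "compatible B (W \<inter> X)"
proof -
  have "v \<in> span (B \<inter> (W \<inter> X))" if v: "v \<in> W" "v \<in> X" for v
  proof -
    have vW: "v \<in> span (B \<inter> W)" and vX: "v \<in> span (B \<inter> X)"
      using v W X by (auto simp: compatible_def)
    have "v \<in> span B" using vW span_mono[of "B \<inter> W" B] by auto
    have rW: "representation B v = representation (B \<inter> W) v"
      using representation_extend[OF B vW] by auto
    have rX: "representation B v = representation (B \<inter> X) v"
      using representation_extend[OF B vX] by auto
    have supp: "b \<in> B \<inter> (W \<inter> X)" if "representation B v b \<noteq> 0" for b
      using that rW rX representation_ne_zero[of "B \<inter> W" v b] representation_ne_zero[of "B \<inter> X" v b]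
      by auto
    have "v = (\<Sum>b | representation B v b \<noteq> 0. representation B v b *s b)"
      using sum_nonzero_representation_eq[OF B \<open>v \<in> span B\<close>] by simp
    also have "\<dots> \<in> span (B \<inter> (W \<inter> X))"
      using supp by (intro span_sum span_scale span_base) auto
    finally show ?thesis .
  qed
  moreover have "span (B \<inter> (W \<inter> X)) \<subseteq> W \<inter> X"
    using W X by (intro span_minimal subspace_inter) (auto intro: compatible_imp_subspace)
  ultimately show ?thesis by (auto simp: compatible_def)
qed

section \<open>Linked basis vectors and one-dimensional subquotients\<close>

definition linked :: "'b set \<Rightarrow> 'b set \<Rightarrow> 'b \<Rightarrow> 'b \<Rightarrow> bool" where
  "linked B B' b b' \<longleftrightarrow>
     (\<forall>W. compatible B W \<longrightarrow> compatible B' W \<longrightarrow> (b \<in> W \<longleftrightarrow> b' \<in> W))"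

lemma linked_sym: "linked B B' b b' \<longleftrightarrow> linked B' B b' b"
  by (auto simp: linked_def)

text \<open>\<open>W / U\<close> is the line spanned by the image of \<open>b\<close>, nonzero
  because \<open>b \<notin> U\<close>.\<close>

definition isolates :: "'b set \<Rightarrow> 'b set \<Rightarrow> 'b set \<Rightarrow> 'b set \<Rightarrow> 'b \<Rightarrow> bool" where
  "isolates B B' W U b \<longleftrightarrow>
     compatible B W \<and> compatible B' W \<and> compatible B U \<and> compatible B' U \<and>
     W = span (insert b U) \<and> b \<notin> U"

lemma isolatesD:
  assumes "isolates B B' W U b"
  shows "compatible B W" "compatible B' W" "compatible B U" "compatible B' U"
    "subspace W" "subspace U" "span U = U" "U \<subseteq> W" "b \<in> W" "b \<notin> U"
    "v \<in> W \<Longrightarrow> \<exists>k. v - k *s b \<in> U"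
proof -
  show 1: "compatible B W" "compatible B' W" "compatible B U" "compatible B' U" "b \<notin> U"
    using assms by (auto simp: isolates_def)
  show "subspace W" "subspace U" "span U = U"
    using 1 compatible_imp_subspace by (auto simp: span_eq_iff)
  have W: "W = span (insert b U)" using assms by (auto simp: isolates_def)
  show "U \<subseteq> W" "b \<in> W" unfolding W using span_superset[of "insert b U"] by auto
  show "\<exists>k. v - k *s b \<in> U" if "v \<in> W"
    using that \<open>span U = U\<close> unfolding W span_insert by auto
qed

lemma isolates_decompose:
  assumes "isolates B B' W U b" "v \<in> W" "v \<notin> U"
  obtains k u where "k \<noteq> 0" "u \<in> U" "v = k *s b + u"
proof -
  obtain k where k: "v - k *s b \<in> U" using isolatesD(11) assms by blast
  have "k \<noteq> 0" using k assms(3) by auto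
  then show ?thesis using that[of k "v - k *s b"] k by auto
qed

text \<open>\<open>b'\<close> is a nonzero multiple of \<open>b\<close> modulo \<open>U\<close>. If
  one of the two lies in \<open>X\<close>, the other lies in \<open>X + U\<close>, which is spanned
  by vectors of its own basis in \<open>X\<close> or in \<open>U\<close>; independence and its
  absence from \<open>U\<close> leave only \<open>X\<close>.\<close>

lemma isolates_linked:
  assumes ind: "independent B" "independent B'"
    and iso: "isolates B B' W U b" and b: "b \<in> B" and b': "b' \<in> B'" "b' \<in> W" "b' \<notin> U"
  shows "linked B B' b b'"
  unfolding linked_def
proof (intro allI impI iffI)
  fix X assume X: "compatible B X" "compatible B' X"
  obtain k u where k: "k \<noteq> 0" and u: "u \<in> U" and eq: "b' = k *s b + u"
    using isolates_decompose[OF iso b'(2,3)] .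
  have uB: "u \<in> span (B \<inter> X \<union> B \<inter> U)" and uB': "u \<in> span (B' \<inter> X \<union> B' \<inter> U)"
    using u isolatesD(3,4)[OF iso] span_mono[of "B \<inter> U" "B \<inter> X \<union> B \<inter> U"]
      span_mono[of "B' \<inter> U" "B' \<inter> X \<union> B' \<inter> U"]
    by (auto simp: compatible_def)
  show "b' \<in> X" if "b \<in> X"
  proof -
    have "b \<in> span (B' \<inter> X \<union> B' \<inter> U)"
      using that X(2) span_mono[of "B' \<inter> X" "B' \<inter> X \<union> B' \<inter> U"] by (auto simp: compatible_def)
    then have "b' \<in> span (B' \<inter> X \<union> B' \<inter> U)"
      unfolding eq using uB' by (intro span_add span_scale)
    then show ?thesis
      using independent_in_span_subset[OF ind(2), of "B' \<inter> X \<union> B' \<inter> U" b'] b' by auto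
  qed
  show "b \<in> X" if "b' \<in> X"
  proof -
    have "b' \<in> span (B \<inter> X \<union> B \<inter> U)"
      using that X(1) span_mono[of "B \<inter> X" "B \<inter> X \<union> B \<inter> U"] by (auto simp: compatible_def)
    then have "inverse k *s (b' - u) \<in> span (B \<inter> X \<union> B \<inter> U)"
      using uB by (intro span_scale span_diff)
    moreover have "inverse k *s (b' - u) = b" using k eq by simp
    ultimately show ?thesis
      using independent_in_span_subset[OF ind(1), of "B \<inter> X \<union> B \<inter> U" b] b isolatesD(10)[OF iso]
      by auto
  qed
qed

lemma isolates_ex:
  assumes "isolates B B' W U b"
  shows "\<exists>b'\<in>B'. b' \<in> W \<and> b' \<notin> U"
proof (rule ccontr)
  assume "\<not> ?thesis"
  then have "B' \<inter> W \<subseteq> U" by auto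
  then have "span (B' \<inter> W) \<subseteq> U"
    using span_minimal isolatesD(6)[OF assms] by blast
  then show False using isolatesD(2,9,10)[OF assms] by (auto simp: compatible_def)
qed

text \<open>Modulo \<open>U\<close> the space \<open>W\<close> is a line, so \<open>b''\<close> is a
  combination of \<open>b'\<close> and vectors of \<open>B'\<close> in \<open>U\<close>;
  independence leaves only \<open>b'\<close>.\<close>

lemma isolates_unique:
  assumes ind: "independent B'" and iso: "isolates B B' W U b"
    and b': "b' \<in> B'" "b' \<in> W" "b' \<notin> U" and b'': "b'' \<in> B'" "b'' \<in> W" "b'' \<notin> U"
  shows "b' = b''"
proof -
  obtain k u where k: "k \<noteq> 0" and u: "u \<in> U" and eq: "b' = k *s b + u"
    using isolates_decompose[OF iso b'(2,3)] .
  obtain l w where l: "l \<noteq> 0" and w: "w \<in> U" and eq': "b'' = l *s b + w"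
    using isolates_decompose[OF iso b''(2,3)] .
  let ?S = "insert b' (B' \<inter> U)"
  have U: "U \<subseteq> span ?S"
    using isolatesD(4)[OF iso] span_mono[of "B' \<inter> U" ?S] by (auto simp: compatible_def)
  have "inverse k *s (b' - u) \<in> span ?S"
    using U u span_base[of b' ?S] by (intro span_scale span_diff) auto
  moreover have "inverse k *s (b' - u) = b" using k eq by simp
  ultimately have "b'' \<in> span ?S"
    unfolding eq' using U w by (intro span_add span_scale) auto
  then have "b'' \<in> ?S" using independent_in_span_subset[OF ind, of ?S b''] b' b'' by auto
  then show ?thesis using b'' by auto
qed

text \<open>The new subquotient embeds in \<open>W / U\<close> and still contains the image of
  \<open>b\<close>. This lets an isolating pair be cut down to the image of a power of
  \<open>f i\<close>.\<close>

lemma isolates_Int: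
  assumes ind: "independent B" "independent B'" and iso: "isolates B B' W U b"
    and X: "compatible B X" "compatible B' X" and b: "b \<in> X"
  shows "isolates B B' (W \<inter> X) (U \<inter> X) b"
proof -
  note D = isolatesD[OF iso]
  have sX: "subspace X" using X compatible_imp_subspace by auto
  have "W \<inter> X \<subseteq> span (insert b (U \<inter> X))"
  proof
    fix v assume v: "v \<in> W \<inter> X"
    then obtain k where k: "v - k *s b \<in> U" using D(11) by auto
    have "v - k *s b \<in> X" using v b sX by (intro subspace_diff subspace_scale) auto
    then have "v - k *s b \<in> span (U \<inter> X)" using k span_base by auto
    then show "v \<in> span (insert b (U \<inter> X))" by (auto simp: span_insert)
  qed
  moreover have "span (insert b (U \<inter> X)) \<subseteq> W \<inter> X"
    using D(8,9) b by (intro span_minimal subspace_inter D(5) sX) auto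
  ultimately have "W \<inter> X = span (insert b (U \<inter> X))" by auto
  moreover have "compatible B (W \<inter> X)" "compatible B' (W \<inter> X)"
    "compatible B (U \<inter> X)" "compatible B' (U \<inter> X)"
    using compatible_Int[OF ind(1)] compatible_Int[OF ind(2)] D(1-4) X by blast+
  ultimately show ?thesis using D(10) unfolding isolates_def by blast
qed

end

section \<open>Depth of weights\<close>

text \<open>Extended by zero to \<open>J \<union> K\<close>, the two coefficient families differ by
  a relation among the roots, which is trivial by independence.\<close>

lemma height_unique:
  fixes \<alpha> :: "'i \<Rightarrow> 'p::ab_group_add"
  assumes inj: "inj_on \<alpha> I" and ind: "\<not> module.dependent zscale (\<alpha> ` I)"
    and J: "finite J" "J \<subseteq> I" and K: "finite K" "K \<subseteq> I"
    and eq: "(\<Sum>i\<in>J. zscale (int (n i)) (\<alpha> i)) = (\<Sum>i\<in>K. zscale (int (m i)) (\<alpha> i))"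
  shows "sum n J = sum m K"
proof -
  interpret module "zscale :: int \<Rightarrow> 'p \<Rightarrow> 'p" by (rule module_zscale)
  define n' where "n' = (\<lambda>i. if i \<in> J then n i else 0)"
  define m' where "m' = (\<lambda>i. if i \<in> K then m i else 0)"
  let ?T = "J \<union> K"
  have T: "finite ?T" "?T \<subseteq> I" using J K by auto
  have inT: "inj_on \<alpha> ?T" using inj T inj_on_subset by blast
  have 1: "(\<Sum>i\<in>?T. zscale (int (n' i)) (\<alpha> i)) = (\<Sum>i\<in>J. zscale (int (n i)) (\<alpha> i))"
    using T by (intro sum.mono_neutral_cong_right) (auto simp: n'_def)
  have 2: "(\<Sum>i\<in>?T. zscale (int (m' i)) (\<alpha> i)) = (\<Sum>i\<in>K. zscale (int (m i)) (\<alpha> i))"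
    using T by (intro sum.mono_neutral_cong_right) (auto simp: m'_def)
  have 3: "(\<Sum>i\<in>?T. zscale (int (n' i) - int (m' i)) (\<alpha> i)) = 0"
    using 1 2 eq by (simp add: scale_left_diff_distrib sum_subtractf)
  \<comment> \<open>Independence is stated for the set of roots, so coefficients are carried from
    indices to roots; \<open>g\<close> inverts \<open>\<alpha>\<close> on \<open>?T\<close>.\<close>
  define g where "g = the_inv_into ?T \<alpha>"
  have g: "g (\<alpha> i) = i" if "i \<in> ?T" for i
    using that inT by (simp add: g_def the_inv_into_f_f)
  have "(\<Sum>x\<in>\<alpha> ` ?T. zscale (int (n' (g x)) - int (m' (g x))) x) =
      (\<Sum>i\<in>?T. zscale (int (n' i) - int (m' i)) (\<alpha> i))"
    unfolding sum.reindex[OF inT] using g by (intro sum.cong) simp_all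
  then have "(\<Sum>x\<in>\<alpha> ` ?T. zscale (int (n' (g x)) - int (m' (g x))) x) = 0"
    using 3 by simp
  then have "int (n' (g x)) - int (m' (g x)) = 0" if "x \<in> \<alpha> ` ?T" for x
    using independentD[OF ind finite_imageI[OF T(1)] image_mono[OF T(2)],
        where u = "\<lambda>x. int (n' (g x)) - int (m' (g x))"] that by blast
  then have "n' i = m' i" if "i \<in> ?T" for i using g that by fastforce
  then have "sum n' ?T = sum m' ?T" by (intro sum.cong) auto
  moreover have "sum n' ?T = sum n J"
    using T by (intro sum.mono_neutral_cong_right) (auto simp: n'_def)
  moreover have "sum m' ?T = sum m K"
    using T by (intro sum.mono_neutral_cong_right) (auto simp: m'_def)
  ultimately show ?thesis by simp
qed

lemma Qplus_add_root:
  fixes \<alpha> :: "'i \<Rightarrow> 'p::ab_group_add"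
  assumes i: "i \<in> I" and J: "finite J" "J \<subseteq> I"
  obtains K m where "finite K" "K \<subseteq> I" "sum m K = Suc (sum n J)"
    "(\<Sum>j\<in>J. zscale (int (n j)) (\<alpha> j)) + \<alpha> i = (\<Sum>j\<in>K. zscale (int (m j)) (\<alpha> j))"
proof
  interpret module "zscale :: int \<Rightarrow> 'p \<Rightarrow> 'p" by (rule module_zscale)
  \<comment> \<open>\<open>n\<close> is unconstrained off \<open>J\<close>, where \<open>i\<close>
    may lie, so it is first cut off to zero there.\<close>
  let ?n = "\<lambda>j. if j \<in> J then n j else 0"
  let ?m = "\<lambda>j. ?n j + (if j = i then 1 else 0)"
  let ?K = "insert i J"
  show K: "finite ?K" "?K \<subseteq> I" using assms by auto
  have "sum ?n ?K = sum n J"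
    using J by (intro sum.mono_neutral_cong_right) auto
  then show "sum ?m ?K = Suc (sum n J)"
    using K by (simp only: sum.distrib) (simp add: sum.delta)
  have 1: "(\<Sum>j\<in>?K. zscale (int (?n j)) (\<alpha> j)) = (\<Sum>j\<in>J. zscale (int (n j)) (\<alpha> j))"
    using J by (intro sum.mono_neutral_cong_right) auto
  have 2: "(\<Sum>j\<in>?K. zscale (int (if j = i then 1 else 0)) (\<alpha> j)) = \<alpha> i"
  proof -
    have "(\<Sum>j\<in>?K. zscale (int (if j = i then 1 else 0)) (\<alpha> j)) = (\<Sum>j\<in>?K. if j = i then \<alpha> j else 0)"
      by (intro sum.cong) auto
    then show ?thesis using K by (simp only: sum.delta) simp
  qed
  show "(\<Sum>j\<in>J. zscale (int (n j)) (\<alpha> j)) + \<alpha> i = (\<Sum>j\<in>?K. zscale (int (?m j)) (\<alpha> j))"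
    by (simp only: of_nat_add scale_left_distrib sum.distrib 1 2)
qed

lemma ex_height:
  fixes \<alpha> :: "'i \<Rightarrow> 'p::ab_group_add"
  assumes inj: "inj_on \<alpha> I" and ind: "\<not> module.dependent zscale (\<alpha> ` I)"
  shows "\<exists>ht :: 'p \<Rightarrow> nat. \<forall>\<beta>\<in>Qplus I \<alpha>. \<forall>i\<in>I.
           \<beta> + \<alpha> i \<in> Qplus I \<alpha> \<and> ht (\<beta> + \<alpha> i) = Suc (ht \<beta>)"
proof -
  define ht where "ht = (\<lambda>\<beta>. THE k. \<exists>J n. finite J \<and> J \<subseteq> I \<and>
    \<beta> = (\<Sum>i\<in>J. zscale (int (n i)) (\<alpha> i)) \<and> k = sum n J)"
  have ht: "ht (\<Sum>i\<in>J. zscale (int (n i)) (\<alpha> i)) = sum n J" if "finite J" "J \<subseteq> I" for J n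
    unfolding ht_def using that
    by (intro the_equality) (blast, metis height_unique[OF inj ind])
  have "\<beta> + \<alpha> i \<in> Qplus I \<alpha> \<and> ht (\<beta> + \<alpha> i) = Suc (ht \<beta>)"
    if \<beta>: "\<beta> \<in> Qplus I \<alpha>" and i: "i \<in> I" for \<beta> i
  proof -
    obtain J n where J: "finite J" "J \<subseteq> I" and eq: "\<beta> = (\<Sum>j\<in>J. zscale (int (n j)) (\<alpha> j))"
      using \<beta> by (auto simp: Qplus_def)
    obtain K m where K: "finite K" "K \<subseteq> I" "sum m K = Suc (sum n J)"
      "\<beta> + \<alpha> i = (\<Sum>j\<in>K. zscale (int (m j)) (\<alpha> j))"
      using Qplus_add_root[OF i J, of n \<alpha>] eq by metis
    then have "\<beta> + \<alpha> i \<in> Qplus I \<alpha>" by (auto simp: Qplus_def)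
    then show ?thesis using ht[OF J, of n] ht[OF K(1,2), of m] K(3,4) eq by simp
  qed
  then show ?thesis by blast
qed

text \<open>\<open>d\<close> adds up the heights of \<open>\<nu> - \<mu>\<close> over the finitely
  many bounding weights \<open>\<nu>\<close>. Adding a root to \<open>\<mu>\<close> increases no
  summand and lowers that of a \<open>\<nu>\<close> bounding
  \<open>\<mu> + \<alpha> i\<close>.\<close>

lemma ex_depth:
  fixes \<alpha> :: "'i \<Rightarrow> 'p::ab_group_add"
  assumes inj: "inj_on \<alpha> I" and ind: "\<not> module.dependent zscale (\<alpha> ` I)"
    and S: "finite S" "X \<subseteq> (\<Union>\<nu>\<in>S. {\<nu> - \<beta> | \<beta>. \<beta> \<in> Qplus I \<alpha>})"
  shows "\<exists>d :: 'p \<Rightarrow> nat. \<forall>\<mu>. \<forall>i\<in>I. \<mu> + \<alpha> i \<in> X \<longrightarrow> d (\<mu> + \<alpha> i) < d \<mu>"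
proof -
  obtain ht :: "'p \<Rightarrow> nat" where ht: "\<And>\<beta> i. \<beta> \<in> Qplus I \<alpha> \<Longrightarrow> i \<in> I \<Longrightarrow>
      \<beta> + \<alpha> i \<in> Qplus I \<alpha> \<and> ht (\<beta> + \<alpha> i) = Suc (ht \<beta>)"
    using ex_height[OF inj ind] by blast
  \<comment> \<open>The value 0 off \<open>Qplus I \<alpha>\<close> keeps the comparison valid: if
    \<open>\<nu> - (\<mu> + \<alpha> i)\<close> is outside \<open>Qplus I \<alpha>\<close>, the term
    for \<open>\<mu> + \<alpha> i\<close> is 0.\<close>
  define t where "t = (\<lambda>\<nu> \<mu>. if \<nu> - \<mu> \<in> Qplus I \<alpha> then ht (\<nu> - \<mu>) else 0)"
  define d where "d = (\<lambda>\<mu>. \<Sum>\<nu>\<in>S. t \<nu> \<mu>)"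
  have "d (\<mu> + \<alpha> i) < d \<mu>" if i: "i \<in> I" and X: "\<mu> + \<alpha> i \<in> X" for \<mu> i
  proof -
    have lt: "t \<nu> (\<mu> + \<alpha> i) < t \<nu> \<mu>" if "\<nu> - (\<mu> + \<alpha> i) \<in> Qplus I \<alpha>" for \<nu>
      using ht[OF that i] that by (simp add: t_def)
    have le: "t \<nu> (\<mu> + \<alpha> i) \<le> t \<nu> \<mu>" for \<nu>
      using lt[of \<nu>] by (cases "\<nu> - (\<mu> + \<alpha> i) \<in> Qplus I \<alpha>") (auto simp: t_def)
    obtain \<nu> \<beta> where \<nu>: "\<nu> \<in> S" "\<beta> \<in> Qplus I \<alpha>" "\<mu> + \<alpha> i = \<nu> - \<beta>"
      using S X by auto
    then have "\<nu> - (\<mu> + \<alpha> i) \<in> Qplus I \<alpha>" by simp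
    then show ?thesis unfolding d_def
      using S(1) \<nu>(1) le lt by (intro sum_strict_mono_ex1) auto
  qed
  then show ?thesis by blast
qed

section \<open>Homogeneous parts\<close>

sublocale graded_vector_space \<subseteq> basis_compatibility scale
  by unfold_locales

context graded_vector_space
begin

definition homogeneous_part :: "'p \<Rightarrow> 'v \<Rightarrow> 'v" where
  "homogeneous_part \<mu> v = (THE x. (\<forall>\<mu>. x \<mu> \<in> Vg \<mu>) \<and> finite {\<mu>. x \<mu> \<noteq> 0} \<and>
     v = (\<Sum>\<mu> | x \<mu> \<noteq> 0. x \<mu>)) \<mu>"

lemma homogeneous_part_eqI:
  assumes "\<And>\<mu>. x \<mu> \<in> Vg \<mu>" "finite T" "\<And>\<mu>. x \<mu> \<noteq> 0 \<Longrightarrow> \<mu> \<in> T" "v = (\<Sum>\<mu>\<in>T. x \<mu>)"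
  shows "homogeneous_part \<mu> v = x \<mu>"
proof -
  have "finite {\<mu>. x \<mu> \<noteq> 0}" using assms(2,3) by (auto intro: finite_subset)
  moreover have "v = (\<Sum>\<mu> | x \<mu> \<noteq> 0. x \<mu>)"
    unfolding assms(4) using assms(2,3) by (intro sum.mono_neutral_right) auto
  ultimately show ?thesis
    unfolding homogeneous_part_def using assms(1)
    by (subst the1_equality[OF direct_sum[of v], of x]) auto
qed

lemma
  shows homogeneous_part_mem: "homogeneous_part \<mu> v \<in> Vg \<mu>"
    and finite_homogeneous_parts: "finite {\<mu>. homogeneous_part \<mu> v \<noteq> 0}"
    and sum_homogeneous_parts: "(\<Sum>\<mu> | homogeneous_part \<mu> v \<noteq> 0. homogeneous_part \<mu> v) = v"
  using theI'[OF direct_sum[of v]] unfolding homogeneous_part_def by auto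

lemma homogeneous_part_homogeneous:
  assumes "v \<in> Vg \<nu>"
  shows "homogeneous_part \<mu> v = (if \<mu> = \<nu> then v else 0)"
  using assms subspace_0[OF subspace_component]
  by (intro homogeneous_part_eqI[of "\<lambda>\<mu>. if \<mu> = \<nu> then v else 0" "{\<nu>}"]) (auto split: if_splits)

lemma sum_homogeneous_parts_superset:
  assumes "finite T" "{\<mu>. homogeneous_part \<mu> v \<noteq> 0} \<subseteq> T"
  shows "(\<Sum>\<mu>\<in>T. homogeneous_part \<mu> v) = v"
proof -
  have "(\<Sum>\<mu>\<in>T. homogeneous_part \<mu> v) =
      (\<Sum>\<mu> | homogeneous_part \<mu> v \<noteq> 0. homogeneous_part \<mu> v)"
    using assms by (intro sum.mono_neutral_right) auto
  then show ?thesis by (simp add: sum_homogeneous_parts)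
qed

lemma linear_homogeneous_part: "Vector_Spaces.linear scale scale (homogeneous_part \<mu>)"
proof (unfold_locales)
  fix v w
  let ?T = "{\<mu>. homogeneous_part \<mu> v \<noteq> 0} \<union> {\<mu>. homogeneous_part \<mu> w \<noteq> 0}"
  show "homogeneous_part \<mu> (v + w) = homogeneous_part \<mu> v + homogeneous_part \<mu> w"
    by (rule homogeneous_part_eqI[of "\<lambda>\<mu>. homogeneous_part \<mu> v + homogeneous_part \<mu> w" ?T])
      (auto simp: sum.distrib sum_homogeneous_parts_superset finite_homogeneous_parts
        intro!: subspace_add[OF subspace_component] homogeneous_part_mem)
next
  fix c v
  let ?T = "{\<mu>. homogeneous_part \<mu> v \<noteq> 0}"
  show "homogeneous_part \<mu> (scale c v) = scale c (homogeneous_part \<mu> v)"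
    by (rule homogeneous_part_eqI[of "\<lambda>\<mu>. scale c (homogeneous_part \<mu> v)" ?T])
      (auto simp: sum_homogeneous_parts finite_homogeneous_parts scale_sum_right[symmetric]
        intro!: subspace_scale[OF subspace_component] homogeneous_part_mem)
qed

text \<open>The projection to degree \<open>\<mu>\<close> fixes or kills each basis vector, so it
  maps \<open>span B\<close> into \<open>span (B \<inter> Vg \<mu>)\<close>, and it is the identity
  on \<open>Vg \<mu>\<close>.\<close>

lemma compatible_component:
  assumes span: "span B = UNIV" and homogeneous: "\<And>b. b \<in> B \<Longrightarrow> \<exists>\<mu>. b \<in> Vg \<mu>"
  shows "compatible B (Vg \<mu>)"
proof -
  interpret part: Vector_Spaces.linear scale scale "homogeneous_part \<mu>" by (rule linear_homogeneous_part)
  have "homogeneous_part \<mu> b \<in> span (B \<inter> Vg \<mu>)" if "b \<in> B" for b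
    using that homogeneous[OF that] homogeneous_part_homogeneous
    by (auto intro: span_base span_zero)
  then have "homogeneous_part \<mu> ` span B \<subseteq> span (B \<inter> Vg \<mu>)"
    unfolding part.span_image[symmetric] by (intro span_minimal) auto
  moreover have "v \<in> homogeneous_part \<mu> ` span B" if "v \<in> Vg \<mu>" for v
    using homogeneous_part_homogeneous[OF that, of \<mu>] span by (metis UNIV_I image_eqI)
  moreover have "span (B \<inter> Vg \<mu>) \<subseteq> Vg \<mu>"
    by (intro span_minimal subspace_component) auto
  ultimately show ?thesis by (auto simp: compatible_def)
qed

end

section \<open>Images of the powers of the operators\<close>

locale rooted_pre_dual_perfect_space = pre_dual_perfect_space scale Vg I \<alpha> f
  for scale :: "'k::field \<Rightarrow> 'v::ab_group_add \<Rightarrow> 'v"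
    and Vg :: "'p::ab_group_add \<Rightarrow> 'v set"
    and I :: "'i set" and \<alpha> :: "'i \<Rightarrow> 'p" and f :: "'i \<Rightarrow> 'v \<Rightarrow> 'v" +
  assumes inj_root: "inj_on \<alpha> I"
    and indep_root: "\<not> module.dependent zscale (\<alpha> ` I)"
begin

text \<open>\<open>ex_depth\<close>, applied to the set of weights, shows that such a function
  exists. It bounds the powers of \<open>f i\<close> that reach a given degree and is the measure
  for induction on the weight.\<close>

definition depth :: "'p \<Rightarrow> nat" where
  "depth = (SOME d. \<forall>\<mu>. \<forall>i\<in>I. Vg (\<mu> + \<alpha> i) \<noteq> {0} \<longrightarrow> d (\<mu> + \<alpha> i) < d \<mu>)"

lemma depth_less: "i \<in> I \<Longrightarrow> Vg (\<mu> + \<alpha> i) \<noteq> {0} \<Longrightarrow> depth (\<mu> + \<alpha> i) < depth \<mu>"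
proof -
  obtain S where S: "finite S" "{\<mu>. Vg \<mu> \<noteq> {0}} \<subseteq> (\<Union>\<nu>\<in>S. {\<nu> - \<beta> | \<beta>. \<beta> \<in> Qplus I \<alpha>})"
    using weights_bounded by blast
  have "\<exists>d :: 'p \<Rightarrow> nat. \<forall>\<mu>. \<forall>i\<in>I. Vg (\<mu> + \<alpha> i) \<noteq> {0} \<longrightarrow> d (\<mu> + \<alpha> i) < d \<mu>"
    using ex_depth[OF inj_root indep_root S] by simp
  from someI_ex[OF this] show "i \<in> I \<Longrightarrow> Vg (\<mu> + \<alpha> i) \<noteq> {0} \<Longrightarrow> ?thesis"
    by (auto simp: depth_def)
qed

lemma linear_funpow_f: "i \<in> I \<Longrightarrow> Vector_Spaces.linear scale scale (f i ^^ n)"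
proof (induction n)
  case 0
  show ?case using linear_id by (simp add: id_def)
next
  case (Suc n)
  have "Vector_Spaces.linear scale scale (f i ^^ n)" "Vector_Spaces.linear scale scale (f i)"
    using Suc linear_f by auto
  from Vector_Spaces.linear_compose[OF this] show ?case by (simp only: funpow.simps(2))
qed

lemma
  assumes i: "i \<in> I"
  shows funpow_f_zero: "(f i ^^ n) 0 = 0"
    and subspace_range_funpow: "subspace (range (f i ^^ n))"
proof -
  interpret fn: Vector_Spaces.linear scale scale "f i ^^ n" using i by (rule linear_funpow_f)
  show "(f i ^^ n) 0 = 0" by (rule fn.zero)
  show "subspace (range (f i ^^ n))" by (intro fn.subspace_image subspace_UNIV)
qed

lemma range_funpow_antimono: "n \<le> m \<Longrightarrow> range (f i ^^ m) \<subseteq> range (f i ^^ n)"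
  by (auto simp: funpow_add dest!: le_Suc_ex)

lemma f_range_funpow: "v \<in> range (f i ^^ n) \<Longrightarrow> f i v \<in> range (f i ^^ Suc n)"
  by auto

lemma f_component: "i \<in> I \<Longrightarrow> v \<in> Vg (\<mu> + \<alpha> i) \<Longrightarrow> f i v \<in> Vg \<mu>"
  using f_degree[of i "\<mu> + \<alpha> i"] by auto

lemma homogeneous_part_f:
  assumes i: "i \<in> I"
  shows "homogeneous_part \<mu> (f i v) = f i (homogeneous_part (\<mu> + \<alpha> i) v)"
proof (rule homogeneous_part_eqI)
  interpret f: Vector_Spaces.linear scale scale "f i" using i by (rule linear_f)
  let ?N = "{\<nu>. homogeneous_part \<nu> v \<noteq> 0}"
  let ?T = "(\<lambda>\<nu>. \<nu> - \<alpha> i) ` ?N"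
  show "f i (homogeneous_part (\<mu> + \<alpha> i) v) \<in> Vg \<mu>" for \<mu>
    using i by (intro f_component homogeneous_part_mem)
  show "finite ?T" by (intro finite_imageI finite_homogeneous_parts)
  show "\<mu> \<in> ?T" if "f i (homogeneous_part (\<mu> + \<alpha> i) v) \<noteq> 0" for \<mu>
    using that f.zero by (intro image_eqI[of _ _ "\<mu> + \<alpha> i"]) auto
  have "(\<Sum>\<mu>\<in>?T. f i (homogeneous_part (\<mu> + \<alpha> i) v)) = (\<Sum>\<nu>\<in>?N. f i (homogeneous_part \<nu> v))"
    by (subst sum.reindex) (auto simp: inj_on_def)
  also have "\<dots> = f i v" by (simp add: f.sum[symmetric] sum_homogeneous_parts)
  finally show "f i v = (\<Sum>\<mu>\<in>?T. f i (homogeneous_part (\<mu> + \<alpha> i) v))" by simp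
qed

lemma homogeneous_part_funpow:
  assumes "i \<in> I"
  shows "homogeneous_part \<mu> ((f i ^^ n) v) =
    (f i ^^ n) (homogeneous_part (((\<lambda>\<nu>. \<nu> + \<alpha> i) ^^ n) \<mu>) v)"
proof (induction n arbitrary: \<mu>)
  case (Suc n)
  have "((\<lambda>\<nu>. \<nu> + \<alpha> i) ^^ Suc n) \<mu> = ((\<lambda>\<nu>. \<nu> + \<alpha> i) ^^ n) (\<mu> + \<alpha> i)"
    by (simp only: funpow_Suc_right o_apply)
  then show ?case using assms Suc by (simp add: homogeneous_part_f)
qed simp

lemma homogeneous_part_range_funpow:
  "i \<in> I \<Longrightarrow> v \<in> range (f i ^^ n) \<Longrightarrow> homogeneous_part \<mu> v \<in> range (f i ^^ n)"
  by (auto simp: homogeneous_part_funpow)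

text \<open>All intermediate vectors are nonzero, so each of the \<open>n\<close> applications of
  \<open>f i\<close> strictly raises the depth of the degree.\<close>

lemma funpow_nonzero_depth:
  assumes "i \<in> I" "v \<in> Vg (((\<lambda>\<nu>. \<nu> + \<alpha> i) ^^ n) \<mu>)" "(f i ^^ n) v \<noteq> 0"
  shows "n \<le> depth \<mu>"
  using assms(2,3)
proof (induction n arbitrary: \<mu>)
  case (Suc n)
  have v: "v \<in> Vg (((\<lambda>\<nu>. \<nu> + \<alpha> i) ^^ n) (\<mu> + \<alpha> i))"
    using Suc.prems(1) by (simp only: funpow_Suc_right o_apply)
  have nz: "(f i ^^ n) v \<noteq> 0" using Suc.prems(2) funpow_f_zero[OF assms(1), of 1] by auto
  have "homogeneous_part (\<mu> + \<alpha> i) ((f i ^^ n) v) = (f i ^^ n) v"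
    using homogeneous_part_funpow[OF assms(1)] homogeneous_part_homogeneous[OF v] by simp
  then have "Vg (\<mu> + \<alpha> i) \<noteq> {0}" using nz homogeneous_part_mem by (metis singletonD)
  then show ?case using Suc.IH[OF v nz] depth_less[OF assms(1)] by (meson Suc_leI le_less_trans)
qed simp

text \<open>Remainders in images of high powers thus disappear degree by degree, even when no power
  of \<open>f i\<close> vanishes on the whole space.\<close>

lemma homogeneous_part_funpow_eq_zero:
  assumes "i \<in> I" "depth \<mu> < n"
  shows "homogeneous_part \<mu> ((f i ^^ n) v) = 0"
  using funpow_nonzero_depth[OF assms(1) homogeneous_part_mem] assms
  by (metis homogeneous_part_funpow leD)

lemma ex_not_in_range_funpow:
  assumes "i \<in> I" "v \<noteq> 0"
  shows "\<exists>n. v \<notin> range (f i ^^ n)"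
proof -
  obtain \<mu> where "homogeneous_part \<mu> v \<noteq> 0"
    using sum_homogeneous_parts[of v] assms(2) by (metis (mono_tags, lifting) sum.neutral)
  then have "v \<notin> range (f i ^^ Suc (depth \<mu>))"
    using homogeneous_part_funpow_eq_zero[OF assms(1) lessI] by auto
  then show ?thesis by blast
qed

text \<open>The images of the powers decrease and do not all contain \<open>v\<close>, so
  \<open>ell f i v\<close> is one less than the first exponent whose image misses \<open>v\<close>.
  This also justifies the definite description in \<open>ell\<close>.\<close>

lemma in_range_funpow_iff:
  assumes i: "i \<in> I" and v: "v \<noteq> 0"
  shows "v \<in> range (f i ^^ n) \<longleftrightarrow> n \<le> ell f i v"
proof -
  define N where "N = (LEAST n. v \<notin> range (f i ^^ n))"
  have N: "v \<notin> range (f i ^^ N)"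
    unfolding N_def using ex_not_in_range_funpow[OF assms] by (rule LeastI_ex)
  have below: "v \<in> range (f i ^^ n)" if "n < N" for n
    using not_less_Least[of n "\<lambda>n. v \<notin> range (f i ^^ n)"] that by (auto simp: N_def)
  have "N \<noteq> 0" using N by (auto intro: ccontr)
  then obtain m where m: "N = Suc m" by (cases N) auto
  have above: "n \<le> m" if "v \<in> range (f i ^^ n)" for n
    using that N m range_funpow_antimono[of N n i] by (meson in_mono not_less_eq_eq)
  have "ell f i v = m" unfolding ell_def
  proof (rule the_equality)
    show "v \<in> range (f i ^^ m) - range (f i ^^ Suc m)" using N below[of m] m by simp
    show "n = m" if n: "v \<in> range (f i ^^ n) - range (f i ^^ Suc n)" for n
    proof -
      have "n \<le> m" "\<not> Suc n < N" using n above below[of "Suc n"] by blast+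
      then show ?thesis using m by simp
    qed
  qed
  then show ?thesis using above below m by auto
qed

end

section \<open>Subspaces compatible with a dual perfect basis\<close>

locale perfect_basis = rooted_pre_dual_perfect_space scale Vg I \<alpha> f
  for scale :: "'k::field \<Rightarrow> 'v::ab_group_add \<Rightarrow> 'v"
    and Vg :: "'p::ab_group_add \<Rightarrow> 'v set"
    and I :: "'i set" and \<alpha> :: "'i \<Rightarrow> 'p" and f :: "'i \<Rightarrow> 'v \<Rightarrow> 'v" +
  fixes B :: "'v set" and F :: "'i \<Rightarrow> 'v \<Rightarrow> 'v"
  assumes basis: "dual_perfect_basis scale Vg I f B F"
begin

declare funpow.simps(2) [simp del]

lemma independent_basis: "independent B"
  and span_basis: "span B = UNIV"
  using basis by (auto simp: dual_perfect_basis_def)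

lemma zero_notin_basis: "0 \<notin> B"
  using independent_basis dependent_zero by auto

lemma basis_homogeneous: "b \<in> B \<Longrightarrow> \<exists>\<mu>. b \<in> Vg \<mu>"
  using basis by (auto simp: dual_perfect_basis_def)

lemma F_mem: "i \<in> I \<Longrightarrow> b \<in> B \<Longrightarrow> F i b \<in> B \<union> {0}"
  using basis unfolding dual_perfect_basis_def by (meson image_subset_iff)

lemma F_inj:
  "i \<in> I \<Longrightarrow> b \<in> B \<Longrightarrow> b' \<in> B \<Longrightarrow> F i b = F i b' \<Longrightarrow> F i b \<noteq> 0 \<Longrightarrow> b = b'"
  using basis unfolding dual_perfect_basis_def by meson

lemma basis_in_range_iff:
  "i \<in> I \<Longrightarrow> b \<in> B \<Longrightarrow> b \<in> range (f i ^^ n) \<longleftrightarrow> n \<le> ell f i b"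
  using in_range_funpow_iff zero_notin_basis by metis

text \<open>Call the image of \<open>f i ^^ n\<close> level \<open>n\<close>. Since
  \<open>ell f i b\<close> is at least \<open>n\<close>, the error term in the basis axiom lies in
  level \<open>n + 2\<close>, and solving for \<open>F i b\<close> puts it in level
  \<open>n + 1\<close>.\<close>

lemma f_basis_decompose:
  assumes i: "i \<in> I" and b: "b \<in> B" "b \<in> range (f i ^^ n)"
  obtains c r where "c \<noteq> 0" "r \<in> range (f i ^^ (n + 2))" "f i b = scale c (F i b) + r"
    "F i b \<in> range (f i ^^ Suc n)"
proof -
  obtain c where c: "c \<noteq> 0" and r: "f i b - scale c (F i b) \<in> range (f i ^^ (ell f i b + 2))"
    using basis i b unfolding dual_perfect_basis_def by meson
  have "n \<le> ell f i b" using basis_in_range_iff i b by auto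
  then have r': "f i b - scale c (F i b) \<in> range (f i ^^ (n + 2))"
    using r range_funpow_antimono[of "n + 2" "ell f i b + 2" i] by auto
  then have "f i b - scale c (F i b) \<in> range (f i ^^ Suc n)"
    using range_funpow_antimono[of "Suc n" "n + 2" i] by (rule subsetD[rotated]) simp
  then have "f i b - (f i b - scale c (F i b)) \<in> range (f i ^^ Suc n)"
    using f_range_funpow[OF b(2)] subspace_diff[OF subspace_range_funpow[OF i]] by blast
  then have "scale (inverse c) (f i b - (f i b - scale c (F i b))) \<in> range (f i ^^ Suc n)"
    by (rule subspace_scale[OF subspace_range_funpow[OF i]])
  moreover have "scale (inverse c) (f i b - (f i b - scale c (F i b))) = F i b" using c by simp
  ultimately have "F i b \<in> range (f i ^^ Suc n)" by metis
  then show ?thesis using that[OF c r'] by auto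
qed

text \<open>Induction by applying \<open>f i\<close>: a basis vector \<open>b\<close> in level
  \<open>n\<close> goes to a multiple of \<open>F i b\<close>, which is a basis vector or zero, plus
  a term in level \<open>n + 2\<close>.\<close>

lemma range_funpow_subset_span:
  assumes i: "i \<in> I"
  shows "range (f i ^^ n) \<subseteq> span (B \<inter> range (f i ^^ n) \<union> range (f i ^^ Suc n))"
proof (induction n)
  case 0
  show ?case using span_basis span_mono[of B "B \<union> range (f i ^^ Suc 0)"] by auto
next
  case (Suc n)
  interpret f: Vector_Spaces.linear scale scale "f i" using i by (rule linear_f)
  let ?S = "B \<inter> range (f i ^^ Suc n) \<union> range (f i ^^ Suc (Suc n))"
  have "f i b \<in> span ?S" if b: "b \<in> B" "b \<in> range (f i ^^ n)" for b
  proof -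
    obtain c r where cr: "c \<noteq> 0" "r \<in> range (f i ^^ (n + 2))" "f i b = scale c (F i b) + r"
      "F i b \<in> range (f i ^^ Suc n)"
      using f_basis_decompose[OF i b] .
    have "F i b \<in> span ?S"
      using F_mem[OF i b(1)] cr(4) by (auto intro: span_base span_zero)
    moreover have "r \<in> span ?S" using cr(2) by (intro span_base) auto
    ultimately show ?thesis unfolding cr(3) by (intro span_add span_scale)
  qed
  moreover have "f i v \<in> span ?S" if "v \<in> range (f i ^^ Suc n)" for v
    using f_range_funpow[OF that] by (intro span_base) auto
  ultimately have "f i ` span (B \<inter> range (f i ^^ n) \<union> range (f i ^^ Suc n)) \<subseteq> span ?S"
    unfolding f.span_image[symmetric] by (intro span_minimal) auto
  moreover have "range (f i ^^ Suc n) = f i ` range (f i ^^ n)" by (auto simp: image_comp funpow.simps(2))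
  ultimately show ?case using image_mono[OF Suc.IH, of "f i"] by simp
qed

lemma range_funpow_subset_span_add:
  assumes i: "i \<in> I"
  shows "range (f i ^^ n) \<subseteq> span (B \<inter> range (f i ^^ n) \<union> range (f i ^^ (n + k)))"
proof (induction k)
  case 0
  show ?case using span_superset by auto
next
  case (Suc k)
  let ?S = "B \<inter> range (f i ^^ n) \<union> range (f i ^^ (n + Suc k))"
  have "span (B \<inter> range (f i ^^ (n + k)) \<union> range (f i ^^ Suc (n + k))) \<subseteq> span ?S"
    using range_funpow_antimono[of n "n + k" i] by (intro span_mono) auto
  then have "range (f i ^^ (n + k)) \<subseteq> span ?S"
    using range_funpow_subset_span[OF i, of "n + k"] by auto
  moreover have "B \<inter> range (f i ^^ n) \<subseteq> span ?S" by (auto intro: span_base)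
  ultimately have "span (B \<inter> range (f i ^^ n) \<union> range (f i ^^ (n + k))) \<subseteq> span ?S"
    by (intro span_minimal) auto
  then show ?case using Suc.IH by auto
qed

lemma compatible_Vg: "compatible B (Vg \<mu>)"
  using span_basis basis_homogeneous by (rule compatible_component)

text \<open>Elements of level \<open>n\<close> are combinations of basis vectors in it up to a
  remainder of arbitrarily high level. In degree \<open>\<mu>\<close> a remainder of level above
  \<open>depth \<mu>\<close> vanishes, and the part of a basis vector is that vector or
  zero.\<close>

lemma compatible_range_funpow:
  assumes i: "i \<in> I"
  shows "compatible B (range (f i ^^ n))"
proof -
  let ?S = "B \<inter> range (f i ^^ n)"
  have hom: "homogeneous_part \<mu> v \<in> span ?S" if "v \<in> range (f i ^^ n)" for \<mu> v
  proof -
    interpret part: Vector_Spaces.linear scale scale "homogeneous_part \<mu>"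
      by (rule linear_homogeneous_part)
    have "v \<in> span (?S \<union> range (f i ^^ (n + Suc (depth \<mu>))))"
      using range_funpow_subset_span_add[OF i] that by blast
    then have "homogeneous_part \<mu> v \<in> span (homogeneous_part \<mu> ` (?S \<union> range (f i ^^ (n + Suc (depth \<mu>)))))"
      unfolding part.span_image by blast
    moreover have "homogeneous_part \<mu> b \<in> span ?S" if b: "b \<in> ?S" for b
    proof -
      obtain \<nu> where "b \<in> Vg \<nu>" using b basis_homogeneous by blast
      then show ?thesis
        using span_base[OF b] span_zero by (simp add: homogeneous_part_homogeneous)
    qed
    moreover have "homogeneous_part \<mu> w \<in> span ?S" if "w \<in> range (f i ^^ (n + Suc (depth \<mu>)))" for w
      using that homogeneous_part_funpow_eq_zero[OF i, of \<mu> "n + Suc (depth \<mu>)"] span_zero by auto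
    ultimately show ?thesis
      using span_minimal[of "homogeneous_part \<mu> ` (?S \<union> range (f i ^^ (n + Suc (depth \<mu>))))" "span ?S"]
      by auto
  qed
  have "v \<in> span ?S" if "v \<in> range (f i ^^ n)" for v
    by (subst sum_homogeneous_parts[symmetric], intro span_sum hom that)
  moreover have "span ?S \<subseteq> range (f i ^^ n)"
    by (intro span_minimal subspace_range_funpow i) auto
  ultimately show ?thesis by (auto simp: compatible_def)
qed

text \<open>\<open>f i\<close> maps basis vectors of level \<open>m\<close> into the span of
  \<open>?S\<close>: those with \<open>ell\<close> exactly \<open>m\<close> contribute
  \<open>F i b'\<close> up to level \<open>m + 2\<close>, the others land in level
  \<open>m + 2\<close>. So \<open>b\<close> is in \<open>?S\<close>, and its \<open>ell\<close>
  rules out level \<open>m + 2\<close>.\<close>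

lemma ex_F_preimage:
  assumes i: "i \<in> I" and b: "b \<in> B" and ell: "ell f i b = Suc m"
  shows "\<exists>b'\<in>B. ell f i b' = m \<and> F i b' = b"
proof -
  interpret f: Vector_Spaces.linear scale scale "f i" using i by (rule linear_f)
  let ?S = "{F i b' | b'. b' \<in> B \<and> ell f i b' = m \<and> F i b' \<noteq> 0} \<union> B \<inter> range (f i ^^ (m + 2))"
  have S: "?S \<subseteq> B" using F_mem[OF i] by auto
  have "f i b' \<in> span ?S" if b': "b' \<in> B" "b' \<in> range (f i ^^ m)" for b'
  proof (cases "ell f i b' = m")
    case True
    obtain c r where cr: "c \<noteq> 0" "r \<in> range (f i ^^ (m + 2))" "f i b' = scale c (F i b') + r"
      using f_basis_decompose[OF i b'] .
    have "r \<in> span (B \<inter> range (f i ^^ (m + 2)))"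
      using cr(2) compatible_range_funpow[OF i] unfolding compatible_def by blast
    also have "\<dots> \<subseteq> span ?S" by (intro span_mono) auto
    finally have "r \<in> span ?S" .
    moreover have "F i b' \<in> span ?S"
    proof (cases "F i b' = 0")
      case False
      then show ?thesis using True b' by (intro span_base) auto
    qed (simp add: span_zero)
    ultimately show ?thesis unfolding cr(3) by (intro span_add span_scale)
  next
    case False
    then have "Suc m \<le> ell f i b'" using basis_in_range_iff[OF i b'(1), of m] b'(2) by simp
    then have "b' \<in> range (f i ^^ Suc m)" using basis_in_range_iff[OF i b'(1)] by blast
    from f_range_funpow[OF this] have "f i b' \<in> range (f i ^^ (m + 2))"
      by (simp only: add_2_eq_Suc')
    then have "f i b' \<in> span (B \<inter> range (f i ^^ (m + 2)))"
      using compatible_range_funpow[OF i] unfolding compatible_def by blast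
    also have "\<dots> \<subseteq> span ?S" by (intro span_mono) auto
    finally show ?thesis .
  qed
  then have "f i ` span (B \<inter> range (f i ^^ m)) \<subseteq> span ?S"
    unfolding f.span_image[symmetric] by (intro span_minimal) auto
  moreover have "b \<in> f i ` range (f i ^^ m)"
    using basis_in_range_iff[OF i b, of "Suc m"] ell by (auto simp: image_comp funpow.simps(2))
  ultimately have "b \<in> span ?S"
    using compatible_range_funpow[OF i, of m] unfolding compatible_def by blast
  then have "b \<in> ?S" by (rule independent_in_span_subset[OF independent_basis S b])
  moreover have "b \<notin> range (f i ^^ (m + 2))" using basis_in_range_iff[OF i b] ell by simp
  ultimately show ?thesis by auto
qed

text \<open>The decomposition of \<open>f i b\<close> gives only a lower bound. Equality holds
  because \<open>ex_F_preimage\<close> yields a preimage of \<open>F i b\<close> with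
  \<open>ell\<close> one less, which is \<open>b\<close> by injectivity of
  \<open>F i\<close>.\<close>

lemma ell_F:
  assumes i: "i \<in> I" and b: "b \<in> B" and nz: "F i b \<noteq> 0"
  shows "ell f i (F i b) = Suc (ell f i b)"
proof -
  have Fb: "F i b \<in> B" using F_mem[OF i b] nz by auto
  have "b \<in> range (f i ^^ ell f i b)" using basis_in_range_iff[OF i b] by simp
  then have "F i b \<in> range (f i ^^ Suc (ell f i b))" using f_basis_decompose[OF i b] by blast
  then have "Suc (ell f i b) \<le> ell f i (F i b)" using basis_in_range_iff[OF i Fb] by blast
  then obtain m where m: "ell f i (F i b) = Suc m" by (cases "ell f i (F i b)") auto
  then obtain b' where "b' \<in> B" "ell f i b' = m" "F i b' = F i b"
    using ex_F_preimage[OF i Fb] by blast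
  then show ?thesis using F_inj[OF i, of b' b] b nz m by auto
qed

text \<open>The basis axioms do not mention the weight of \<open>F i b\<close>. Were it not shifted
  by \<open>\<alpha> i\<close>, the part of \<open>f i b\<close> in degree \<open>\<mu>\<close>
  would vanish and \<open>F i b\<close> would lie in level \<open>ell f i b + 2\<close>, against
  \<open>ell_F\<close>.\<close>

lemma F_component:
  assumes i: "i \<in> I" and b: "b \<in> B" and nz: "F i b \<noteq> 0" and \<mu>: "F i b \<in> Vg \<mu>"
  shows "b \<in> Vg (\<mu> + \<alpha> i)"
proof -
  obtain \<nu> where \<nu>: "b \<in> Vg \<nu>" using basis_homogeneous b by blast
  have "\<nu> = \<mu> + \<alpha> i"
  proof (rule ccontr)
    assume ne: "\<nu> \<noteq> \<mu> + \<alpha> i"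
    interpret part: Vector_Spaces.linear scale scale "homogeneous_part \<mu>"
      by (rule linear_homogeneous_part)
    interpret f: Vector_Spaces.linear scale scale "f i" using i by (rule linear_f)
    obtain c r where cr: "c \<noteq> 0" "r \<in> range (f i ^^ (ell f i b + 2))" "f i b = scale c (F i b) + r"
      using f_basis_decompose[OF i b, of "ell f i b"] basis_in_range_iff[OF i b, of "ell f i b"] by blast
    have "homogeneous_part \<mu> (f i b) = 0"
      unfolding homogeneous_part_f[OF i] homogeneous_part_homogeneous[OF \<nu>] using ne f.zero by simp
    moreover have "homogeneous_part \<mu> (f i b) = scale c (F i b) + homogeneous_part \<mu> r"
      unfolding cr(3) part.add part.scale homogeneous_part_homogeneous[OF \<mu>] by simp
    ultimately have "scale c (F i b) = - homogeneous_part \<mu> r" by (simp add: eq_neg_iff_add_eq_0)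
    then have "F i b = scale (inverse c) (- homogeneous_part \<mu> r)"
      using cr(1) by (metis scale_scale left_inverse scale_one)
    also have "\<dots> \<in> range (f i ^^ (ell f i b + 2))"
      using i cr(2) by (intro subspace_scale subspace_neg subspace_range_funpow
          homogeneous_part_range_funpow)
    finally show False
      using F_mem[OF i b] nz basis_in_range_iff[OF i, of "F i b"] ell_F[OF i b nz] by auto
  qed
  then show ?thesis using \<nu> by simp
qed

text \<open>Modulo level \<open>n + 2\<close>, \<open>f i\<close> acts on the basis vectors in
  \<open>W\<close> as \<open>F i\<close> up to nonzero scalars. Zero values are removed so that the
  right-hand side is spanned by a subset of \<open>B\<close>.\<close>

lemma span_f_image:
  assumes i: "i \<in> I" and W: "compatible B W" "W \<subseteq> range (f i ^^ n)"
  shows "span (f i ` W \<union> range (f i ^^ (n + 2))) =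
    span ((F i ` (B \<inter> W) - {0}) \<union> B \<inter> range (f i ^^ (n + 2)))"
    (is "span ?L = span ?R")
proof (rule antisym)
  interpret f: Vector_Spaces.linear scale scale "f i" using i by (rule linear_f)
  have range: "range (f i ^^ (n + 2)) \<subseteq> span ?R"
    using compatible_range_funpow[OF i, of "n + 2"] span_mono[of "B \<inter> range (f i ^^ (n + 2))" ?R]
    unfolding compatible_def by blast
  have dec: "\<exists>c r. c \<noteq> 0 \<and> r \<in> range (f i ^^ (n + 2)) \<and> f i b = scale c (F i b) + r"
    if b: "b \<in> B \<inter> W" for b
  proof -
    have "b \<in> B" "b \<in> range (f i ^^ n)" using b W by auto
    then show ?thesis using f_basis_decompose[OF i] by metis
  qed
  have "f i b \<in> span ?R" if b: "b \<in> B \<inter> W" for b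
  proof -
    obtain c r where "r \<in> range (f i ^^ (n + 2))" "f i b = scale c (F i b) + r"
      using dec[OF b] by blast
    moreover have "F i b \<in> span ?R"
      using b by (cases "F i b = 0") (auto intro: span_zero span_base)
    ultimately show ?thesis using range by (auto intro: span_add span_scale)
  qed
  then have "f i ` span (B \<inter> W) \<subseteq> span ?R"
    unfolding f.span_image[symmetric] by (intro span_minimal) auto
  then have "f i ` W \<subseteq> span ?R" using W(1) unfolding compatible_def by simp
  then show "span ?L \<subseteq> span ?R" using range by (intro span_minimal) auto
  have "F i b \<in> span ?L" if b: "b \<in> B \<inter> W" for b
  proof -
    obtain c r where cr: "c \<noteq> 0" "r \<in> range (f i ^^ (n + 2))" "f i b = scale c (F i b) + r"
      using dec[OF b] by blast
    have "f i b \<in> span ?L" "r \<in> span ?L" using b cr(2) by (auto intro: span_base simp del: add_2_eq_Suc')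
    then have "scale (inverse c) (f i b - r) \<in> span ?L" by (intro span_scale span_diff)
    then show ?thesis using cr(1,3) by simp
  qed
  then show "span ?R \<subseteq> span ?L" by (intro span_minimal) (auto intro: span_base)
qed

lemma compatible_f_image:
  assumes "i \<in> I" "compatible B W" "W \<subseteq> range (f i ^^ n)"
  shows "compatible B (span (f i ` W \<union> range (f i ^^ (n + 2))))"
  unfolding span_f_image[OF assms]
  using F_mem[OF assms(1)] by (intro compatible_span independent_basis) auto

text \<open>By \<open>span_f_image\<close>, membership would put \<open>F i b\<close> in level
  \<open>ell f i b + 2\<close>, excluded by \<open>ell_F\<close>, or make it \<open>F i b'\<close>
  with \<open>b'\<close> in \<open>U\<close>, excluded by injectivity.\<close>

lemma F_notin_span_f_image:
  assumes i: "i \<in> I" and U: "compatible B U" "U \<subseteq> range (f i ^^ ell f i b)"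
    and b: "b \<in> B" "b \<notin> U" "F i b \<noteq> 0"
  shows "F i b \<notin> span (f i ` U \<union> range (f i ^^ (ell f i b + 2)))"
proof
  let ?S = "(F i ` (B \<inter> U) - {0}) \<union> B \<inter> range (f i ^^ (ell f i b + 2))"
  have Fb: "F i b \<in> B" using F_mem[OF i] b by auto
  assume "F i b \<in> span (f i ` U \<union> range (f i ^^ (ell f i b + 2)))"
  then have span: "F i b \<in> span ?S" unfolding span_f_image[OF i U] .
  have "?S \<subseteq> B" using F_mem[OF i] by auto
  then have "F i b \<in> ?S" using span by (rule independent_in_span_subset[OF independent_basis _ Fb])
  moreover have "F i b \<notin> range (f i ^^ (ell f i b + 2))"
    unfolding basis_in_range_iff[OF i Fb] ell_F[OF i b(1,3)] by simp
  ultimately obtain b' where "b' \<in> B" "b' \<in> U" "F i b = F i b'" by blast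
  then show False using F_inj[OF i b(1) \<open>b' \<in> B\<close>] b by simp
qed

lemma compatible_funpow_image:
  assumes i: "i \<in> I" and W: "compatible B W"
  shows "compatible B (span ((f i ^^ n) ` W \<union> range (f i ^^ Suc n)))"
proof (induction n)
  case 0
  show ?case using W compatible_range_funpow[OF i, of 1] compatible_Un by simp
next
  case (Suc n)
  interpret f: Vector_Spaces.linear scale scale "f i" using i by (rule linear_f)
  let ?X = "span ((f i ^^ n) ` W \<union> range (f i ^^ Suc n))"
  have X: "?X \<subseteq> range (f i ^^ n)"
    using range_funpow_antimono[of n "Suc n" i] by (intro span_minimal subspace_range_funpow i) auto
  have "f i ` ?X = span ((f i ^^ Suc n) ` W \<union> range (f i ^^ Suc (Suc n)))"
    unfolding f.span_image[symmetric] by (simp add: image_Un image_comp funpow.simps(2))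
  \<comment> \<open>Level \<open>n + 2\<close> is already contained in the inner span, so adding it
    changes nothing.\<close>
  moreover have "span (span ((f i ^^ Suc n) ` W \<union> range (f i ^^ Suc (Suc n))) \<union> range (f i ^^ (n + 2))) =
      span ((f i ^^ Suc n) ` W \<union> range (f i ^^ Suc (Suc n)))"
    by (intro antisym span_minimal Un_least subset_refl subspace_span) (auto intro: span_base)
  ultimately show ?case using compatible_f_image[OF i Suc.IH X] by simp
qed

section \<open>The filtrations attached to a sequence of indices\<close>

lemma linear_f_prod:
  "range ii \<subseteq> I \<Longrightarrow> Vector_Spaces.linear scale scale (f_prod f ii l m)"
proof (induction m)
  case 0
  show ?case using linear_id by (simp add: id_def)
next
  case (Suc m)
  then have "Vector_Spaces.linear scale scale (f (ii m) ^^ l m)" by (intro linear_funpow_f) auto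
  from Vector_Spaces.linear_compose[OF this Suc.IH[OF Suc.prems]] show ?case by (simp only: f_prod.simps)
qed

text \<open>The innermost factor is peeled off: \<open>W\<close> is replaced by its image under that
  power plus the image of the next power, which is compatible. The outer product turns the added
  image into the summand with index \<open>m\<close>.\<close>

lemma compatible_f_prod_image:
  assumes ii: "range ii \<subseteq> I" and "compatible B W"
  shows "compatible B (span (f_prod f ii l m ` W \<union>
    (\<Union>k<m. range (f_prod f ii l k \<circ> (f (ii k) ^^ (1 + l k))))))"
  using assms(2)
proof (induction m arbitrary: W)
  case 0
  then show ?case using compatible_imp_subspace by (simp add: span_eq_iff[THEN iffD2])
next
  case (Suc m)
  interpret fp: Vector_Spaces.linear scale scale "f_prod f ii l m" using ii by (rule linear_f_prod)
  let ?R = "\<lambda>m. \<Union>k<m. range (f_prod f ii l k \<circ> (f (ii k) ^^ (1 + l k)))"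
  let ?X = "(f (ii m) ^^ l m) ` W \<union> range (f (ii m) ^^ Suc (l m))"
  have "f_prod f ii l m ` ?X \<union> ?R m = f_prod f ii l (Suc m) ` W \<union> ?R (Suc m)"
    by (auto simp: lessThan_Suc image_Un image_comp funpow.simps(2))
  moreover have "span (f_prod f ii l m ` span ?X \<union> ?R m) = span (f_prod f ii l m ` ?X \<union> ?R m)"
    unfolding fp.span_image[symmetric]
    by (intro antisym span_minimal Un_least subspace_span span_mono) (auto intro: span_base)
  moreover have "compatible B (span (f_prod f ii l m ` span ?X \<union> ?R m))"
    using Suc.prems ii by (intro Suc.IH compatible_funpow_image) auto
  ultimately show ?case by metis
qed

text \<open>A summand is handled only together with the earlier ones: \<open>?T k\<close> collects
  the summands up to \<open>k\<close>, and all \<open>?T k\<close> together have the same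
  span.\<close>

lemma compatible_V_gt:
  assumes ii: "range ii \<subseteq> I"
  shows "compatible B (V_gt scale f l ii)"
proof -
  let ?r = "\<lambda>k. range (f_prod f ii l k \<circ> (f (ii k) ^^ (1 + l k)))"
  let ?T = "\<lambda>k. span (?r k \<union> (\<Union>j<k. ?r j))"
  have "compatible B (?T k)" for k
    using compatible_f_prod_image[OF ii compatible_range_funpow, of "ii k" l k "1 + l k"] ii
    by (auto simp: image_comp funpow.simps(2))
  then have "compatible B (span (\<Union>(range ?T)))" by (intro compatible_Union) auto
  moreover have "span (\<Union>(range ?T)) = V_gt scale f l ii"
  proof (rule antisym)
    have "?T k \<subseteq> span (\<Union>k. ?r k)" for k by (intro span_mono) auto
    then show "span (\<Union>(range ?T)) \<subseteq> V_gt scale f l ii"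
      unfolding V_gt_def by (intro span_minimal) auto
    have "?r k \<subseteq> ?T k" for k by (auto intro: span_base)
    then show "V_gt scale f l ii \<subseteq> span (\<Union>(range ?T))"
      unfolding V_gt_def by (intro span_mono) blast
  qed
  ultimately show ?thesis by simp
qed

text \<open>As \<open>l\<close> vanishes from \<open>M\<close> on, the products stabilise and
  \<open>V_ge\<close> is \<open>V_gt\<close> plus the image of one product. That image becomes
  compatible after adding summands that \<open>V_gt\<close> already contains.\<close>

lemma compatible_V_ge:
  assumes ii: "range ii \<subseteq> I" and l: "good_nat_seq l"
  shows "compatible B (V_ge scale f l ii)"
proof -
  let ?G = "V_gt scale f l ii"
  obtain M where M: "\<And>m. M \<le> m \<Longrightarrow> l m = 0"
    using l by (auto simp: good_nat_seq_def eventually_sequentially)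
  have stable: "f_prod f ii l m = f_prod f ii l M" if "M \<le> m" for m
    using that by (induction m rule: dec_induct) (auto simp: M)
  interpret fp: Vector_Spaces.linear scale scale "f_prod f ii l M" using ii by (rule linear_f_prod)
  have sub: "subspace ?G" "subspace (range (f_prod f ii l M))"
    by (auto simp: V_gt_def fp.subspace_image)
  let ?T = "span (range (f_prod f ii l M) \<union>
    (\<Union>k<M. range (f_prod f ii l k \<circ> (f (ii k) ^^ (1 + l k)))))"
  have "?G + range (f_prod f ii l M) = span (?G \<union> range (f_prod f ii l M))"
  proof -
    have eq: "span ?G = ?G" "span (range (f_prod f ii l M)) = range (f_prod f ii l M)"
      using sub span_eq_iff by blast+
    show ?thesis unfolding span_Un set_plus_def eq by blast
  qed
  also have "\<dots> = span (?G \<union> ?T)"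
  proof (rule antisym)
    show "span (?G \<union> range (f_prod f ii l M)) \<subseteq> span (?G \<union> ?T)"
      by (intro span_mono) (auto intro: span_base)
    have "(\<Union>k<M. range (f_prod f ii l k \<circ> (f (ii k) ^^ (1 + l k)))) \<subseteq> ?G"
      unfolding V_gt_def by (auto intro!: span_base)
    then have "?T \<subseteq> span (?G \<union> range (f_prod f ii l M))"
      by (intro span_mono) auto
    then show "span (?G \<union> ?T) \<subseteq> span (?G \<union> range (f_prod f ii l M))"
      by (intro span_minimal) (auto intro: span_base)
  qed
  finally have eq: "?G + range (f_prod f ii l M) = span (?G \<union> ?T)" .
  have "compatible B UNIV" using span_basis by (simp add: compatible_def)
  then have "compatible B (?G + range (f_prod f ii l M))"
    unfolding eq by (intro compatible_Un compatible_V_gt compatible_f_prod_image ii)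
  moreover have "V_ge scale f l ii = ?G + range (f_prod f ii l M)"
  proof -
    have "(\<forall>\<^sub>F m in sequentially. v \<in> ?G + range (f_prod f ii l m)) \<longleftrightarrow>
        (\<forall>\<^sub>F m in sequentially. v \<in> ?G + range (f_prod f ii l M))" for v
      by (rule eventually_cong[OF eventually_ge_at_top[of M]]) (drule stable, simp only:)
    then show ?thesis by (simp add: V_ge_def)
  qed
  ultimately show ?thesis by simp
qed

end

section \<open>Matching two dual perfect bases\<close>

locale perfect_basis_pair =
  B: perfect_basis scale Vg I \<alpha> f B F + B': perfect_basis scale Vg I \<alpha> f B' F'
  for scale :: "'k::field \<Rightarrow> 'v::ab_group_add \<Rightarrow> 'v"
    and Vg :: "'p::ab_group_add \<Rightarrow> 'v set"
    and I :: "'i set" and \<alpha> :: "'i \<Rightarrow> 'p" and f :: "'i \<Rightarrow> 'v \<Rightarrow> 'v"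
    and B B' :: "'v set" and F F' :: "'i \<Rightarrow> 'v \<Rightarrow> 'v" +
  assumes pH_highest: "pH scale I f ` highest I f B = pH scale I f ` highest I f B'"
begin

text \<open>Exchanging the bases later gives preimages under the matching and the vanishing of
  \<open>F'\<close> where \<open>F\<close> vanishes.\<close>

lemma perfect_basis_pair_swap: "perfect_basis_pair scale Vg I \<alpha> f B' B F' F"
  using pH_highest by unfold_locales simp

section \<open>The radical and the highest basis vectors\<close>

definition rad :: "'v set" where
  "rad = B.span (\<Union>i\<in>I. range (f i))"

lemma subspace_rad: "B.subspace rad"
  by (simp add: rad_def)

lemma pH_eq_iff: "pH scale I f v = pH scale I f w \<longleftrightarrow> v - w \<in> rad"
proof
  assume "pH scale I f v = pH scale I f w"
  moreover have "v \<in> pH scale I f v"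
    using B.subspace_0[OF subspace_rad] by (auto simp: pH_def rad_def elt_set_plus_def intro!: bexI[of _ 0])
  ultimately show "v - w \<in> rad" by (auto simp: pH_def rad_def elt_set_plus_def)
next
  assume d: "v - w \<in> rad"
  have sub: "v +o rad \<subseteq> w +o rad" if "v - w \<in> rad" for v w
  proof
    fix x assume "x \<in> v +o rad"
    then obtain r where "r \<in> rad" "x = v + r" by (auto simp: elt_set_plus_def)
    then have "x = w + ((v - w) + r)" "(v - w) + r \<in> rad"
      using that B.subspace_add[OF subspace_rad] by auto
    then show "x \<in> w +o rad" unfolding elt_set_plus_def by blast
  qed
  have "w - v \<in> rad" using B.subspace_neg[OF subspace_rad d] by simp
  then show "pH scale I f v = pH scale I f w"
    using sub[OF d] sub[of w v] by (auto simp: pH_def rad_def)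
qed

lemma compatible_rad: "B.compatible B rad" "B.compatible B' rad"
proof -
  have "B.compatible B (range (f i))" "B.compatible B' (range (f i))" if "i \<in> I" for i
    using B.compatible_range_funpow[OF that, of 1] B'.compatible_range_funpow[OF that, of 1]
    by (simp_all add: funpow.simps(2))
  then show "B.compatible B rad" "B.compatible B' rad"
    unfolding rad_def by (auto intro!: B.compatible_Union)
qed

text \<open>\<open>rad\<close> is spanned by the basis vectors in the images of the
  \<open>f i\<close>, so a basis vector in \<open>rad\<close> lies in one of these images and has
  \<open>ell\<close> at least 1 for that index.\<close>

lemma highest_notin_rad:
  assumes "b \<in> highest I f B"
  shows "b \<notin> rad"
proof
  assume "b \<in> rad"
  have b: "b \<in> B" using assms by (simp add: highest_def)
  let ?S = "\<Union>i\<in>I. B \<inter> range (f i)"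
  have "range (f i) \<subseteq> B.span ?S" if "i \<in> I" for i
  proof -
    have "range (f i) = B.span (B \<inter> range (f i))"
      using B.compatible_range_funpow[OF that, of 1] by (simp add: B.compatible_def funpow.simps(2))
    also have "\<dots> \<subseteq> B.span ?S" using that by (intro B.span_mono) auto
    finally show ?thesis .
  qed
  then have "rad \<subseteq> B.span ?S" unfolding rad_def by (intro B.span_minimal) auto
  then have "b \<in> B.span ?S" using \<open>b \<in> rad\<close> by blast
  moreover have "?S \<subseteq> B" by auto
  ultimately have "b \<in> ?S"
    using B.independent_in_span_subset[OF B.independent_basis _ b] by metis
  then obtain i where i: "i \<in> I" "b \<in> range (f i ^^ 1)" by (auto simp: funpow.simps(2))
  then have "1 \<le> ell f i b" using B.basis_in_range_iff[OF i(1) b] by metis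
  then show False using assms i(1) by (auto simp: highest_def)
qed

text \<open>A vector \<open>b'\<close> of \<open>B'\<close> with the same coset spans the same space
  as \<open>b\<close> over \<open>rad\<close>; the two descriptions give compatibility with
  \<open>B\<close> and with \<open>B'\<close>.\<close>

lemma isolates_highest:
  assumes b: "b \<in> highest I f B"
  shows "B.isolates B B' (B.span (insert b rad)) rad b"
proof -
  obtain b' where b': "b' \<in> highest I f B'" "pH scale I f b = pH scale I f b'"
    using b pH_highest by (metis (no_types, lifting) image_iff)
  then have d: "b - b' \<in> rad" by (simp add: pH_eq_iff)
  have ins: "B.compatible C (B.span (insert c rad))"
    if "B.independent C" "c \<in> C" "B.compatible C rad" for C c
  proof -
    have "B.compatible C (B.span (B.span {c} \<union> rad))"
      using that by (intro B.compatible_Un B.compatible_span) auto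
    moreover have "B.span (B.span {c} \<union> rad) = B.span (insert c rad)"
    proof (rule antisym)
      have "B.span {c} \<subseteq> B.span (insert c rad)" by (intro B.span_mono) auto
      then show "B.span (B.span {c} \<union> rad) \<subseteq> B.span (insert c rad)"
        by (intro B.span_minimal) (auto intro: B.span_base)
      show "B.span (insert c rad) \<subseteq> B.span (B.span {c} \<union> rad)"
        by (intro B.span_mono) (auto intro: B.span_base)
    qed
    ultimately show ?thesis by simp
  qed
  have "B.span (insert b rad) = B.span (insert b' rad)"
  proof (rule antisym)
    have "b' \<in> B.span (insert b' rad)" "b - b' \<in> B.span (insert b' rad)"
      using d by (auto intro: B.span_base)
    from B.span_add[OF this] have "b \<in> B.span (insert b' rad)" by simp
    then show "B.span (insert b rad) \<subseteq> B.span (insert b' rad)"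
      by (intro B.span_minimal) (auto intro: B.span_base)
    have "b \<in> B.span (insert b rad)" "b - b' \<in> B.span (insert b rad)"
      using d by (auto intro: B.span_base)
    from B.span_diff[OF this] have "b' \<in> B.span (insert b rad)" by simp
    then show "B.span (insert b' rad) \<subseteq> B.span (insert b rad)"
      by (intro B.span_minimal) (auto intro: B.span_base)
  qed
  moreover have "b \<in> B" "b' \<in> B'" using b b' by (auto simp: highest_def)
  ultimately show ?thesis
    using ins[OF B.independent_basis _ compatible_rad(1)]
      ins[OF B'.independent_basis _ compatible_rad(2)] compatible_rad highest_notin_rad[OF b]
    unfolding B.isolates_def by metis
qed

text \<open>The error term in \<open>f i b\<close> lies in the new \<open>U\<close>, so
  \<open>f i\<close> carries the line \<open>W / U\<close> to the line of \<open>F i b\<close>.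
  Confining \<open>W\<close> to level \<open>ell f i b\<close> makes
  \<open>compatible_f_image\<close> applicable; \<open>F_notin_span_f_image\<close> shows that the
  new line is nonzero.\<close>

lemma isolates_F:
  assumes i: "i \<in> I" and b: "b \<in> B" and nz: "F i b \<noteq> 0"
    and iso: "B.isolates B B' W U b" and W: "W \<subseteq> range (f i ^^ ell f i b)"
  shows "B.isolates B B' (B.span (f i ` W \<union> range (f i ^^ (ell f i b + 2))))
    (B.span (f i ` U \<union> range (f i ^^ (ell f i b + 2)))) (F i b)"
    (is "B.isolates B B' ?W ?U _")
proof -
  note D = B.isolatesD[OF iso]
  interpret f: Vector_Spaces.linear scale scale "f i" using i by (rule B.linear_f)
  have U: "U \<subseteq> range (f i ^^ ell f i b)" using W D(8) by auto
  obtain c r where cr: "c \<noteq> 0" "r \<in> range (f i ^^ (ell f i b + 2))" "f i b = scale c (F i b) + r"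
    using B.f_basis_decompose[OF i b, of "ell f i b"] B.basis_in_range_iff[OF i b, of "ell f i b"]
    by blast
  have rU: "r \<in> ?U" using cr(2) by (intro B.span_base UnI2)
  have "?W = B.span (insert (F i b) ?U)"
  proof (rule antisym)
    have UU: "?U \<subseteq> B.span (insert (F i b) ?U)" by (auto intro: B.span_base)
    have "scale c (F i b) \<in> B.span (insert (F i b) ?U)" by (intro B.span_scale B.span_base) simp
    moreover have "r \<in> B.span (insert (F i b) ?U)" using UU rU by (rule subsetD)
    ultimately have "scale c (F i b) + r \<in> B.span (insert (F i b) ?U)" by (rule B.span_add)
    moreover have "f i ` U \<subseteq> ?U" by (auto intro: B.span_base)
    ultimately have "f i ` insert b U \<subseteq> B.span (insert (F i b) ?U)"
      using UU cr(3) by auto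
    then have "f i ` B.span (insert b U) \<subseteq> B.span (insert (F i b) ?U)"
      unfolding f.span_image[symmetric] by (intro B.span_minimal) auto
    then have "f i ` W \<subseteq> B.span (insert (F i b) ?U)" using iso by (simp add: B.isolates_def)
    moreover have "range (f i ^^ (ell f i b + 2)) \<subseteq> ?U" by (intro subsetI B.span_base UnI2)
    ultimately show "?W \<subseteq> B.span (insert (F i b) ?U)"
      using UU by (intro B.span_minimal) auto
    have "?U \<subseteq> ?W" using D(8) by (intro B.span_mono) auto
    moreover have "F i b \<in> ?W"
    proof -
      have "f i b \<in> ?W" using D(9) by (intro B.span_base) auto
      moreover have "r \<in> ?W" using rU \<open>?U \<subseteq> ?W\<close> by blast
      ultimately have "scale (inverse c) (f i b - r) \<in> ?W" by (intro B.span_scale B.span_diff)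
      then show ?thesis using cr(1,3) by simp
    qed
    ultimately show "B.span (insert (F i b) ?U) \<subseteq> ?W" by (intro B.span_minimal) auto
  qed
  moreover have "B.compatible B ?W" "B.compatible B' ?W" "B.compatible B ?U" "B.compatible B' ?U"
    by (rule B.compatible_f_image[OF i D(1) W] B'.compatible_f_image[OF i D(2) W]
        B.compatible_f_image[OF i D(3) U] B'.compatible_f_image[OF i D(4) U])+
  moreover have "F i b \<notin> ?U" using B.F_notin_span_f_image[OF i D(3) U b D(10) nz] .
  ultimately show ?thesis by (simp add: B.isolates_def)
qed

text \<open>Prepares \<open>isolates_F\<close>, which asks for \<open>W\<close> inside the deepest
  image of a power of \<open>f i\<close> containing \<open>b\<close>.\<close>

lemma isolates_range_Int:
  assumes i: "i \<in> I" and b: "b \<in> B" and iso: "B.isolates B B' W U b"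
  shows "B.isolates B B' (W \<inter> range (f i ^^ ell f i b)) (U \<inter> range (f i ^^ ell f i b)) b"
  using B.isolates_Int[OF B.independent_basis B'.independent_basis iso]
    B.compatible_range_funpow[OF i] B'.compatible_range_funpow[OF i] B.basis_in_range_iff[OF i b]
  by blast

text \<open>Induction on the depth: a basis vector that is not highest is \<open>F i b0\<close> for
  some \<open>i\<close>, and \<open>b0\<close> has degree \<open>\<mu> + \<alpha> i\<close>, of
  smaller depth.\<close>

lemma ex_isolates: "b \<in> B \<Longrightarrow> b \<in> Vg \<mu> \<Longrightarrow> \<exists>W U. B.isolates B B' W U b"
proof (induction "B.depth \<mu>" arbitrary: b \<mu> rule: less_induct)
  case less
  show ?case
  proof (cases "\<forall>i\<in>I. ell f i b = 0")
    case True
    then have "b \<in> highest I f B" using less.prems by (simp add: highest_def)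
    then show ?thesis using isolates_highest by blast
  next
    case False
    then obtain i m where i: "i \<in> I" and "ell f i b = Suc m" by (metis not0_implies_Suc)
    then obtain b0 where b0: "b0 \<in> B" "F i b0 = b"
      using B.ex_F_preimage less.prems by blast
    have nz: "F i b0 \<noteq> 0" using b0 less.prems B.zero_notin_basis by auto
    have wt: "b0 \<in> Vg (\<mu> + \<alpha> i)" using B.F_component[OF i b0(1) nz] b0 less.prems by simp
    then have "Vg (\<mu> + \<alpha> i) \<noteq> {0}" using b0 B.zero_notin_basis by auto
    then obtain W U where "B.isolates B B' W U b0"
      using less.hyps[OF B.depth_less[OF i] b0(1) wt] by blast
    then show ?thesis
      using isolates_F[OF i b0(1) nz isolates_range_Int[OF i b0(1)]] b0(2) by blast
  qed
qed

section \<open>The matching of the two bases\<close>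

lemma ex1_linked:
  assumes b: "b \<in> B"
  shows "\<exists>!b'. b' \<in> B' \<and> B.linked B B' b b'"
proof -
  obtain W U where iso: "B.isolates B B' W U b"
    using ex_isolates b B.basis_homogeneous by blast
  obtain b' where b': "b' \<in> B'" "b' \<in> W" "b' \<notin> U"
    using B.isolates_ex[OF iso] by blast
  have "b'' = b'" if "b'' \<in> B'" "B.linked B B' b b''" for b''
  proof -
    have "b'' \<in> W" "b'' \<notin> U"
      using that(2) B.isolatesD(1-4,9,10)[OF iso] unfolding B.linked_def by blast+
    then show ?thesis using B.isolates_unique[OF B'.independent_basis iso] that b' by blast
  qed
  moreover have "B.linked B B' b b'"
    using B.isolates_linked[OF B.independent_basis B'.independent_basis iso b b'] .
  ultimately show ?thesis using b' by blast
qed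

text \<open>The value 0 off \<open>B\<close> gives \<open>match 0 = 0\<close>, as
  \<open>crystal_iso\<close> requires.\<close>

definition match :: "'v \<Rightarrow> 'v" where
  "match b = (if b \<in> B then THE b'. b' \<in> B' \<and> B.linked B B' b b' else 0)"

lemma match_zero: "match 0 = 0"
  using B.zero_notin_basis by (simp add: match_def)

lemma
  assumes "b \<in> B"
  shows match_mem: "match b \<in> B'" and linked_match: "B.linked B B' b (match b)"
  using theI'[OF ex1_linked[OF assms]] assms by (auto simp: match_def)

lemma match_eqI: "b \<in> B \<Longrightarrow> b' \<in> B' \<Longrightarrow> B.linked B B' b b' \<Longrightarrow> match b = b'"
  using ex1_linked match_mem linked_match by blast

text \<open>\<open>linked\<close> is symmetric, so preimages under \<open>match\<close> are the
  partners that \<open>ex1_linked\<close> gives for the exchanged bases.\<close>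

lemma ex1_match_eq:
  assumes b': "b' \<in> B'"
  shows "\<exists>!b. b \<in> B \<and> match b = b'"
proof -
  interpret s: perfect_basis_pair scale Vg I \<alpha> f B' B F' F by (rule perfect_basis_pair_swap)
  have "b \<in> B \<and> match b = b' \<longleftrightarrow> b \<in> B \<and> B.linked B' B b' b" for b
    using match_eqI[of b b'] linked_match[of b] b' B.linked_sym[of B B'] by metis
  then show ?thesis using s.ex1_linked[OF b'] by simp
qed

lemma bij_match: "bij_betw match B B'"
proof (rule bij_betw_imageI)
  show "inj_on match B"
  proof (rule inj_onI)
    fix b c assume "b \<in> B" "c \<in> B" "match b = match c"
    then show "b = c" using ex1_match_eq[OF match_mem[of b]] by metis
  qed
  show "match ` B = B'"
  proof
    show "match ` B \<subseteq> B'" using match_mem by auto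
    show "B' \<subseteq> match ` B"
    proof
      fix b' assume "b' \<in> B'"
      then obtain b where "b \<in> B" "match b = b'" using ex1_match_eq by metis
      then show "b' \<in> match ` B" by blast
    qed
  qed
qed

text \<open>Transfer principle: it makes every invariant read off from such subspaces agree, in
  particular the weight, \<open>ell\<close> and \<open>L_seq\<close>.\<close>

lemma match_in_iff:
  "b \<in> B \<Longrightarrow> B.compatible B W \<Longrightarrow> B.compatible B' W \<Longrightarrow> match b \<in> W \<longleftrightarrow> b \<in> W"
  using linked_match by (auto simp: B.linked_def)

lemma match_isolates:
  assumes "b \<in> B" "B.isolates B B' W U b"
  shows "match b \<in> W" "match b \<notin> U"
  using match_in_iff[OF assms(1)] B.isolatesD[OF assms(2)] by auto

text \<open>The vector of \<open>B'\<close> with the same coset lies in \<open>?W\<close> and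
  outside \<open>rad\<close>, as does \<open>match b\<close>; only one vector of \<open>B'\<close>
  does so.\<close>

lemma match_highest:
  assumes b: "b \<in> highest I f B"
  shows "pH scale I f b = pH scale I f (match b)"
proof -
  obtain b' where b': "b' \<in> highest I f B'" "pH scale I f b = pH scale I f b'"
    using b pH_highest by (metis (no_types, lifting) image_iff)
  then have d: "b - b' \<in> rad" by (simp add: pH_eq_iff)
  let ?W = "B.span (insert b rad)"
  have bB: "b \<in> B" "b' \<in> B'" using b b' by (auto simp: highest_def)
  have "b \<in> ?W" "b - b' \<in> ?W" using d by (auto intro: B.span_base)
  from B.span_diff[OF this] have W: "b' \<in> ?W" by simp
  have "b' \<notin> rad"
    using B.subspace_add[OF subspace_rad d, of b'] highest_notin_rad[OF b] by auto
  then have "b' = match b"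
    using B.isolates_unique[OF B'.independent_basis isolates_highest[OF b]] bB W
      match_isolates[OF bB(1) isolates_highest[OF b]] match_mem[OF bB(1)] by blast
  then show ?thesis using b' by simp
qed

lemma match_ell:
  assumes i: "i \<in> I" and b: "b \<in> B"
  shows "ell f i (match b) = ell f i b"
proof -
  have "match b \<in> range (f i ^^ n) \<longleftrightarrow> b \<in> range (f i ^^ n)" for n
    using match_in_iff[OF b] B.compatible_range_funpow[OF i] B'.compatible_range_funpow[OF i] .
  then show ?thesis unfolding ell_def by (simp only: Diff_iff)
qed

text \<open>Both sides are vectors of \<open>B'\<close> in the moved \<open>?W\<close> and outside
  the moved \<open>?U\<close>, so \<open>isolates_unique\<close> identifies them.\<close>

lemma match_F_nonzero:
  assumes i: "i \<in> I" and b: "b \<in> B" and nz: "F i b \<noteq> 0"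
  shows "F' i (match b) = match (F i b)"
proof -
  obtain W0 U0 where iso0: "B.isolates B B' W0 U0 b"
    using ex_isolates b B.basis_homogeneous by blast
  define n where "n = ell f i b"
  define W where "W = W0 \<inter> range (f i ^^ n)"
  define U where "U = U0 \<inter> range (f i ^^ n)"
  have iso: "B.isolates B B' W U b"
    using isolates_range_Int[OF i b iso0] by (simp add: W_def U_def n_def)
  let ?W = "B.span (f i ` W \<union> range (f i ^^ (n + 2)))"
  let ?U = "B.span (f i ` U \<union> range (f i ^^ (n + 2)))"
  have iso': "B.isolates B B' ?W ?U (F i b)"
    using isolates_F[OF i b nz iso] by (simp add: W_def n_def)
  note D = B.isolatesD[OF iso] and D' = B.isolatesD[OF iso']
  have m: "match b \<in> B'" "match b \<in> W" "match b \<notin> U"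
    using match_mem match_isolates b iso by auto
  obtain k u where k: "k \<noteq> 0" and u: "u \<in> U" and eq: "match b = scale k b + u"
    using B.isolates_decompose[OF iso m(2,3)] .
  interpret f: Vector_Spaces.linear scale scale "f i" using i by (rule B.linear_f)
  have "b \<in> range (f i ^^ n)" "match b \<in> range (f i ^^ n)"
    using B.isolatesD(9)[OF iso] m(2) by (auto simp: W_def)
  obtain c r where cr: "c \<noteq> 0" "r \<in> range (f i ^^ (n + 2))" "f i b = scale c (F i b) + r"
    using B.f_basis_decompose[OF i b \<open>b \<in> range (f i ^^ n)\<close>] .
  obtain c' r' where cr': "c' \<noteq> 0" "r' \<in> range (f i ^^ (n + 2))"
      "f i (match b) = scale c' (F' i (match b)) + r'"
    using B'.f_basis_decompose[OF i m(1) \<open>match b \<in> range (f i ^^ n)\<close>] .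
  have r: "r \<in> ?U" "r' \<in> ?U" using cr(2) cr'(2) by (auto intro!: B.span_base simp del: add_2_eq_Suc')
  have fu: "f i u \<in> ?U" using u by (auto intro: B.span_base)
  have F': "F' i (match b) \<in> ?W"
  proof -
    have "f i (match b) \<in> ?W" using m(2) by (auto intro: B.span_base)
    then have "scale (inverse c') (f i (match b) - r') \<in> ?W"
      using r D'(8) by (intro B.span_scale B.span_diff) auto
    then show ?thesis using cr' by simp
  qed
  have nU: "F' i (match b) \<notin> ?U"
  proof
    assume "F' i (match b) \<in> ?U"
    then have "f i (match b) \<in> ?U"
      unfolding cr'(3) using r by (intro B.span_add B.span_scale)
    \<comment> \<open>Modulo \<open>?U\<close>, \<open>f i (match b)\<close> is \<open>F i b\<close>
      with the nonzero coefficient \<open>k * c\<close>, so \<open>F i b\<close> would lie in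
      \<open>?U\<close>.\<close>
    then have "f i (match b) - f i u - scale k r \<in> ?U"
      using fu r by (intro B.span_diff B.span_scale)
    also have "f i (match b) - f i u - scale k r = scale (k * c) (F i b)"
      unfolding eq f.add f.scale cr(3) by (simp add: B.scale_right_distrib)
    finally have "scale (inverse (k * c)) (scale (k * c) (F i b)) \<in> ?U" by (rule B.span_scale)
    moreover have "scale (inverse (k * c)) (scale (k * c) (F i b)) = F i b"
      using k cr(1) by (simp del: inverse_mult_distrib)
    ultimately show False using D'(10) by metis
  qed
  have "F' i (match b) \<noteq> 0" using nU B.span_zero by metis
  then have F'B: "F' i (match b) \<in> B'" using B'.F_mem[OF i m(1)] by auto
  have FB: "F i b \<in> B" using B.F_mem[OF i b] nz by auto
  show ?thesis
    using B.isolates_unique[OF B'.independent_basis iso' F'B F' nU match_mem[OF FB]]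
      match_isolates[OF FB iso'] by blast
qed

lemma match_F:
  assumes i: "i \<in> I" and b: "b \<in> B"
  shows "F' i (match b) = match (F i b)"
proof (cases "F i b = 0")
  case True
  \<comment> \<open>If \<open>F' i (match b)\<close> were nonzero, the nonzero case for the
    exchanged bases would make its partner equal to \<open>F i b = 0\<close>, which is not in
    \<open>B\<close>.\<close>
  interpret s: perfect_basis_pair scale Vg I \<alpha> f B' B F' F by (rule perfect_basis_pair_swap)
  have "s.match (match b) = b"
    using s.match_eqI[OF match_mem[OF b] b] linked_match[OF b] B.linked_sym by blast
  moreover have False if nz: "F' i (match b) \<noteq> 0"
  proof -
    have "F' i (match b) \<in> B'" using B'.F_mem[OF i match_mem[OF b]] nz by auto
    then have "s.match (F' i (match b)) \<in> B" by (rule s.match_mem)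
    then show False
      using s.match_F_nonzero[OF i match_mem[OF b] nz] True \<open>s.match (match b) = b\<close>
        B.zero_notin_basis by simp
  qed
  ultimately have "F' i (match b) = 0" by blast
  then show ?thesis using True match_zero by simp
qed (use assms match_F_nonzero in blast)

end

section \<open>Crystal operators and good sequences\<close>

context perfect_basis
begin

lemma wt_of_eqI: "v \<noteq> 0 \<Longrightarrow> v \<in> Vg \<mu> \<Longrightarrow> wt_of Vg v = \<mu>"
  unfolding wt_of_def
  by (intro the_equality) (assumption, metis homogeneous_part_homogeneous)

lemma bold_e_F:
  assumes i: "i \<in> I" and b: "b \<in> B" and nz: "F i b \<noteq> 0"
  shows "bold_e B F i (F i b) = b"
proof -
  have "(THE b'. b' \<in> B \<and> F i b' = F i b) = b"
    using F_inj[OF i b] b nz by (intro the_equality) metis+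
  then show ?thesis using F_mem[OF i b] b nz by (auto simp: bold_e_def)
qed

lemma bold_e_step:
  assumes i: "i \<in> I" and b: "b \<in> B" and ell: "ell f i b = Suc m"
  shows "bold_e B F i b \<in> B" "ell f i (bold_e B F i b) = m"
    "depth (wt_of Vg (bold_e B F i b)) < depth (wt_of Vg b)"
proof -
  obtain b' where b': "b' \<in> B" "ell f i b' = m" "F i b' = b"
    using ex_F_preimage[OF assms] by blast
  have nz: "F i b' \<noteq> 0" using b' b zero_notin_basis by auto
  have e: "bold_e B F i b = b'" using bold_e_F[OF i b'(1) nz] b'(3) by simp
  show "bold_e B F i b \<in> B" "ell f i (bold_e B F i b) = m" using e b' by auto
  obtain \<mu> where \<mu>: "b \<in> Vg \<mu>" using basis_homogeneous[OF b] by blast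
  then have \<mu>': "b' \<in> Vg (\<mu> + \<alpha> i)" using F_component[OF i b'(1) nz] b'(3) by simp
  have "b' \<noteq> 0" "b \<noteq> 0" using b b' zero_notin_basis by auto
  then have "wt_of Vg b = \<mu>" "wt_of Vg b' = \<mu> + \<alpha> i" "Vg (\<mu> + \<alpha> i) \<noteq> {0}"
    using wt_of_eqI \<mu> \<mu>' by auto
  then show "depth (wt_of Vg (bold_e B F i b)) < depth (wt_of Vg b)"
    using depth_less[OF i] e by simp
qed

lemma bold_e_funpow:
  assumes i: "i \<in> I" and b: "b \<in> B"
  shows "n \<le> ell f i b \<Longrightarrow> (bold_e B F i ^^ n) b \<in> B \<and>
    ell f i ((bold_e B F i ^^ n) b) = ell f i b - n \<and>
    depth (wt_of Vg ((bold_e B F i ^^ n) b)) + n \<le> depth (wt_of Vg b)"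
proof (induction n)
  case (Suc n)
  let ?c = "(bold_e B F i ^^ n) b"
  have c: "?c \<in> B" "ell f i ?c = Suc (ell f i b - Suc n)"
    "depth (wt_of Vg ?c) + n \<le> depth (wt_of Vg b)"
    using Suc by auto
  show ?case using bold_e_step[OF i c(1,2)] c(3) by (simp add: funpow.simps(2))
qed (use b in simp)

lemma
  assumes "i \<in> I" "b \<in> B"
  shows e_top_mem: "e_top f B F i b \<in> B"
    and e_top_depth: "depth (wt_of Vg (e_top f B F i b)) + ell f i b \<le> depth (wt_of Vg b)"
  using bold_e_funpow[OF assms, of "ell f i b"] by (auto simp: e_top_def)

lemma e_top_upto_mem: "range ii \<subseteq> I \<Longrightarrow> b \<in> B \<Longrightarrow> e_top_upto f B F ii m b \<in> B"
  by (induction m) (auto intro!: e_top_mem)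

text \<open>The depth of the weight is nonincreasing along the partial products, so they are constant
  from the point on where it is minimal.\<close>

lemma e_top_upto_stable:
  assumes good: "good_index_seq I ii" and b: "b \<in> B"
  shows "\<exists>M. e_top_upto f B F ii M b \<in> highest I f B \<and>
    (\<forall>m\<ge>M. e_top_upto f B F ii m b = e_top_upto f B F ii M b)"
proof -
  let ?u = "\<lambda>m. e_top_upto f B F ii m b"
  let ?d = "\<lambda>m. depth (wt_of Vg (?u m))"
  have ii: "range ii \<subseteq> I" using good by (simp add: good_index_seq_def)
  have u: "?u m \<in> B" for m using e_top_upto_mem[OF ii b] .
  have step: "?d (Suc m) + ell f (ii m) (?u m) \<le> ?d m" for m
    using e_top_depth[OF _ u, of "ii m" m] ii by auto
  obtain M where M: "\<And>m. ?d M \<le> ?d m"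
    using ex_has_least_nat[of "\<lambda>_. True" 0 ?d] by auto
  have stable: "?u m = ?u M" if "M \<le> m" for m
    using that
  proof (induction m rule: dec_induct)
    case (step m)
    then have "ell f (ii m) (?u m) = 0"
      using \<open>?d (Suc m) + ell f (ii m) (?u m) \<le> ?d m\<close> M[of "Suc m"] by simp
    then show ?case using step by (simp add: e_top_def)
  qed simp
  have "ell f i (?u M) = 0" if i: "i \<in> I" for i
  proof -
    have "infinite {k. ii k = i}" using good i by (simp add: good_index_seq_def)
    \<comment> \<open>Goodness of \<open>ii\<close> gives an index \<open>m\<close> beyond
      \<open>M\<close> with \<open>ii m = i\<close>; constancy of the partial products there forces
      \<open>ell\<close> to vanish.\<close>
    then have "\<not> {k. ii k = i} \<subseteq> {..<M}" using finite_subset by blast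
    then obtain m where m: "M \<le> m" "ii m = i" using leI by blast
    have "?u m = ?u M" "?u (Suc m) = ?u M" using stable[of m] stable[of "Suc m"] m by auto
    then show ?thesis using step[of m] m by (simp del: e_top_upto.simps)
  qed
  then have "?u M \<in> highest I f B" using u by (simp add: highest_def)
  then show ?thesis using stable by blast
qed

end

lemma e_top_seq_eqI:
  assumes "\<And>m. M \<le> m \<Longrightarrow> e_top_upto f B F ii m b = c"
  shows "e_top_seq f B F ii b = c"
proof -
  have ev: "\<forall>\<^sub>F m in sequentially. e_top_upto f B F ii m b = c"
    using assms by (auto simp: eventually_sequentially)
  have "d = c" if "\<forall>\<^sub>F m in sequentially. e_top_upto f B F ii m b = d" for d
    using eventually_happens'[OF sequentially_bot eventually_conj[OF ev that]] by auto
  then show ?thesis unfolding e_top_seq_def using ev by (rule the_equality[rotated])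
qed

context perfect_basis_pair
begin

lemma match_bold_e:
  assumes i: "i \<in> I" and b: "b \<in> B"
  shows "bold_e B' F' i (match b) = match (bold_e B F i b)"
proof (cases "\<exists>b0\<in>B. F i b0 = b")
  case True
  then obtain b0 where b0: "b0 \<in> B" "F i b0 = b" by blast
  have nz: "F i b0 \<noteq> 0" "match b \<noteq> 0"
    using b b0 B.zero_notin_basis B'.zero_notin_basis match_mem[OF b] by auto
  have F': "F' i (match b0) = match b" using match_F[OF i b0(1)] b0 by simp
  show ?thesis
    using B.bold_e_F[OF i b0(1) nz(1)] B'.bold_e_F[OF i match_mem[OF b0(1)]] F' nz b0(2) by simp
next
  case False
  \<comment> \<open>A preimage in \<open>B'\<close> would be \<open>match b0\<close> for some
    \<open>b0\<close>; as \<open>match\<close> commutes with the operators and is injective,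
    \<open>F i b0\<close> would be \<open>b\<close>.\<close>
  have "\<not> (\<exists>b'\<in>B'. F' i b' = match b)"
  proof
    assume "\<exists>b'\<in>B'. F' i b' = match b"
    then obtain b0 where b0: "b0 \<in> B" "F' i (match b0) = match b"
      using bij_match by (metis bij_betw_iff_bijections)
    then have eq: "match (F i b0) = match b" using match_F[OF i b0(1)] by simp
    have "F i b0 \<noteq> 0" using eq match_zero match_mem[OF b] B'.zero_notin_basis by auto
    then have "F i b0 \<in> B" using B.F_mem[OF i b0(1)] by auto
    then have "F i b0 = b" using eq ex1_match_eq[OF match_mem[OF b]] b by metis
    then show False using False b0(1) by blast
  qed
  then have "bold_e B' F' i (match b) = 0" "bold_e B F i b = 0"
    using False by (auto simp: bold_e_def)
  then show ?thesis using match_zero by simp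
qed

lemma match_e_top:
  assumes i: "i \<in> I" and b: "b \<in> B"
  shows "e_top f B' F' i (match b) = match (e_top f B F i b)"
proof -
  have "(bold_e B' F' i ^^ n) (match b) = match ((bold_e B F i ^^ n) b)" if "n \<le> ell f i b" for n
    using that
  proof (induction n)
    case (Suc n)
    then show ?case
      using B.bold_e_funpow[OF i b, of n] match_bold_e[OF i] by (simp add: funpow.simps(2))
  qed simp
  then show ?thesis using match_ell[OF i b] by (simp add: e_top_def)
qed

lemma match_e_top_upto:
  assumes ii: "range ii \<subseteq> I" and b: "b \<in> B"
  shows "e_top_upto f B' F' ii m (match b) = match (e_top_upto f B F ii m b)"
proof (induction m)
  case (Suc m)
  have "ii m \<in> I" using ii by auto
  then show ?case using match_e_top[OF _ B.e_top_upto_mem[OF ii b]] Suc by simp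
qed simp

lemma match_wt: "b \<in> B \<Longrightarrow> wt_of Vg (match b) = wt_of Vg b"
  using match_in_iff[OF _ B.compatible_Vg B'.compatible_Vg] by (simp add: wt_of_def)

lemma match_L_seq:
  assumes ii: "range ii \<subseteq> I" and b: "b \<in> B"
  shows "L_seq scale f ii (match b) = L_seq scale f ii b"
proof -
  have "match b \<in> V_ge scale f l ii \<longleftrightarrow> b \<in> V_ge scale f l ii" if "good_nat_seq l" for l
    using match_in_iff[OF b B.compatible_V_ge[OF ii that] B'.compatible_V_ge[OF ii that]] .
  \<comment> \<open>Compatibility of \<open>V_ge\<close> is available for good \<open>l\<close>, and
    \<open>L_seq\<close> tests membership only together with goodness.\<close>
  then have "good_nat_seq l \<and> match b \<in> V_ge scale f l ii \<longleftrightarrow>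
      good_nat_seq l \<and> b \<in> V_ge scale f l ii" for l
    by blast
  then show ?thesis unfolding L_seq_def conj_assoc[symmetric] by presburger
qed

lemma crystal_iso_match:
  "crystal_iso I (dual_perfect_graph I a h Vg f B F) (dual_perfect_graph I a h Vg f B' F') match"
proof -
  have "eps_of I a f i (match b) = eps_of I a f i b" if "b \<in> B" for i b
    using match_ell[OF _ that] by (auto simp: eps_of_def I_re_def)
  then show ?thesis
    using bij_match match_zero match_wt match_bold_e match_F
    by (simp add: crystal_iso_def dual_perfect_graph_def)
qed

text \<open>The index from which the partial products for \<open>b\<close> are constant also serves
  \<open>match b\<close>, since \<open>match\<close> commutes with each partial product.\<close>

lemma match_e_top_seq:
  assumes good: "good_index_seq I ii" and b: "b \<in> B"
  shows "e_top_seq f B F ii b \<in> highest I f B"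
    and "e_top_seq f B' F' ii (match b) = match (e_top_seq f B F ii b)"
proof -
  have ii: "range ii \<subseteq> I" using good by (simp add: good_index_seq_def)
  obtain M where M: "e_top_upto f B F ii M b \<in> highest I f B"
    "\<And>m. M \<le> m \<Longrightarrow> e_top_upto f B F ii m b = e_top_upto f B F ii M b"
    using B.e_top_upto_stable[OF assms] by blast
  have seq: "e_top_seq f B F ii b = e_top_upto f B F ii M b"
    using M(2) by (rule e_top_seq_eqI)
  show "e_top_seq f B F ii b \<in> highest I f B" using M(1) seq by simp
  have "e_top_upto f B' F' ii m (match b) = match (e_top_upto f B F ii M b)" if "M \<le> m" for m
    unfolding match_e_top_upto[OF ii b] M(2)[OF that] ..
  then show "e_top_seq f B' F' ii (match b) = match (e_top_seq f B F ii b)"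
    unfolding seq by (rule e_top_seq_eqI)
qed

end

theorem theorem6p1:
  fixes I :: "'i set"
    and a :: "'i \<Rightarrow> 'i \<Rightarrow> int"
    and \<alpha> :: "'i \<Rightarrow> 'p::ab_group_add"
    and h :: "'i \<Rightarrow> 'p \<Rightarrow> int"
    and scale :: "'k::field \<Rightarrow> 'v::ab_group_add \<Rightarrow> 'v"
    and Vg :: "'p \<Rightarrow> 'v set"
    and f F F' :: "'i \<Rightarrow> 'v \<Rightarrow> 'v"
    and B B' :: "'v set"
  assumes "borcherds_cartan_datum I a \<alpha> h"
    and "dual_perfect_space scale Vg I \<alpha> f"
    and "dual_perfect_basis scale Vg I f B F"
    and "dual_perfect_basis scale Vg I f B' F'"
    and "pH scale I f ` highest I f B = pH scale I f ` highest I f B'"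
  shows "\<exists>\<psi>. crystal_iso I (dual_perfect_graph I a h Vg f B F)
                  (dual_perfect_graph I a h Vg f B' F') \<psi> \<and>
             (\<forall>b\<in>highest I f B. pH scale I f b = pH scale I f (\<psi> b)) \<and>
             (\<forall>b\<in>B. \<forall>ii. good_index_seq I ii \<longrightarrow>
                L_seq scale f ii b = L_seq scale f ii (\<psi> b) \<and>
                pH scale I f (e_top_seq f B F ii b) = pH scale I f (e_top_seq f B' F' ii (\<psi> b)) \<and>
                pH scale I f (e_top_seq f B F ii b) \<in> pH scale I f ` highest I f B)"
proof -
  interpret pre_dual_perfect_space scale Vg I \<alpha> f
    using assms(2) by (simp add: dual_perfect_space_def)
  interpret datum: borcherds_cartan_datum I a \<alpha> h by (rule assms(1))
  interpret perfect_basis_pair scale Vg I \<alpha> f B B' F F'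
    using datum.inj_root datum.indep_root assms(3-5) by unfold_locales auto
  show ?thesis
  proof (intro exI[of _ match] conjI ballI allI impI)
    show "crystal_iso I (dual_perfect_graph I a h Vg f B F) (dual_perfect_graph I a h Vg f B' F') match"
      by (rule crystal_iso_match)
    show "pH scale I f b = pH scale I f (match b)" if "b \<in> highest I f B" for b
      using that by (rule match_highest)
    fix b ii
    assume b: "b \<in> B" and good: "good_index_seq I ii"
    show "L_seq scale f ii b = L_seq scale f ii (match b)"
      using match_L_seq[OF _ b] good by (simp add: good_index_seq_def)
    show "pH scale I f (e_top_seq f B F ii b) = pH scale I f (e_top_seq f B' F' ii (match b))"
      using match_e_top_seq[OF good b] match_highest by simp
    show "pH scale I f (e_top_seq f B F ii b) \<in> pH scale I f ` highest I f B"
      using match_e_top_seq(1)[OF good b] by (rule imageI)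
  qed
qed

end
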